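(* Consider the telegraph generator $Lf(x,y)=y\partial_xf(x,y)+a(x,y)\big(f(x,-y)-f(x,y)\big)$ on $\mathbb R\times\{-1,1\}$. Assume that $a(\cdot,1)$ and $a(\cdot,-1)$ are positive, smooth, bounded and with bounded derivatives, that $a_*:=\min_{\mathbb R}\big(a(\cdot,1)+a(\cdot,-1)\big)>0$, and that $U(x)=\int_0^x(a(z,1)-a(z,-1))dz$ is smooth with bounded $U''$ and such that $\mu_1\propto e^{-U(x)}dx$ satisfies a Poincaré inequality with constant $c_U>0$. Then there exist $\lambda>0$, $\eta>0$ and $\nu_*\in\mathbb R$ with $\mathcal Re(\eta-\sqrt{-\nu_*})>0$ (that is, either $\nu_*\ge0$, or $\nu_*<0$ and $\sqrt{|\nu_*|}<\eta$) such that for every $f\in\mathcal D$ there is a function $t\mapsto\nu_t$ with $\nu_t\ge\nu_*$ for all $t\ge0$ such that $F_t=\|P_tf-\mu f\|^2_{L^2(\mu)}$ satisfies, for all $t\ge0$, $$(\partial_t+\lambda)\Big[(\partial_t+\eta)^2+\nu_t\Big]F_t\le 0 .$$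
   Context: The left-hand side means $g'(t)+\lambda g(t)$ with $g(t)=F_t''+2\eta F_t'+(\eta^2+\nu_t)F_t$ (in particular $\nu_tF_t$ is differentiable in $t$). $(P_t)_{t\ge0}$ is the Markov semigroup with generator $L$, i.e. $P_tf(x,y)=\mathbb E(f(X_t,Y_t)\mid X_0=x,Y_0=y)$ for the process with $dX_t=Y_tdt$ and $Y_t\in\{-1,1\}$ jumping to $-Y_t$ at rate $a(X_t,Y_t)$. Its invariant measure is the probability measure $\mu\propto e^{-U(x)}dx\otimes\frac12(\delta_1+\delta_{-1})(dy)$, with first marginal $\mu_1$; $\mu f=\int f\,d\mu$. A probability measure $\nu$ on $\mathbb R$ satisfies a Poincaré inequality with constant $c$ if $\int|g'|^2d\nu\ge c\int|g|^2d\nu$ whenever $\int g\,d\nu=0$. Standing assumption: $\mathcal D$ is a core, dense in $L^2(\mu)$ and stable by $L$, and $f\in\mathcal D$; it is understood that the functions $f_t=P_tf-\mu f$ are regular enough that $\|\partial_xf_t\|^2$ is finite and differentiable in $t$, and that the operators involved can be applied to $f_t$ and integrated by parts in $L^2(\mu)$. *)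

theory Defs
  imports "HOL-Probability.Probability"
begin

section \<open>Real functions and square integrability\<close>

definition smooth :: "(real \<Rightarrow> real) \<Rightarrow> bool" where
  "smooth g \<longleftrightarrow> (\<forall>n x. (deriv ^^ n) g field_differentiable at x)"

definition L2 :: "'a measure \<Rightarrow> ('a \<Rightarrow> real) set" where
  "L2 M = {f \<in> borel_measurable M. integrable M (\<lambda>z. (f z)\<^sup>2)}"

definition sqnorm :: "'a measure \<Rightarrow> ('a \<Rightarrow> real) \<Rightarrow> real" where
  "sqnorm M f = (\<integral>z. (f z)\<^sup>2 \<partial>M)"

text \<open>The test functions are the continuously differentiable ones for which both sides are finite.\<close>

definition poincare :: "real measure \<Rightarrow> real \<Rightarrow> bool" where
  "poincare M c \<longleftrightarrow>
     (\<forall>g g'. (\<forall>x. (g has_real_derivative g' x) (at x)) \<and> continuous_on UNIV g' \<and>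
        g \<in> L2 M \<and> g' \<in> L2 M \<and> (\<integral>x. g x \<partial>M) = 0 \<longrightarrow>
        c * sqnorm M g \<le> sqnorm M g')"


section \<open>Markov semigroups on \<open>L\<^sup>2\<close>, generators and cores\<close>

text \<open>Elements of \<^term>\<open>L2 M\<close> are functions, not classes, so all identities hold almost
  everywhere.  The last three clauses are contractivity, invariance of \<open>M\<close> and
  strong continuity.\<close>

definition markov_semigroup ::
  "'a measure \<Rightarrow> (real \<Rightarrow> ('a \<Rightarrow> real) \<Rightarrow> 'a \<Rightarrow> real) \<Rightarrow> bool" where
  "markov_semigroup M P \<longleftrightarrow>
     (\<forall>t\<ge>0. \<forall>f\<in>L2 M. P t f \<in> L2 M) \<and>
     (\<forall>t\<ge>0. \<forall>f\<in>L2 M. \<forall>g\<in>L2 M. \<forall>c.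
        AE z in M. P t (\<lambda>w. c * f w + g w) z = c * P t f z + P t g z) \<and>
     (\<forall>t\<ge>0. \<forall>f\<in>L2 M. (AE z in M. 0 \<le> f z) \<longrightarrow> (AE z in M. 0 \<le> P t f z)) \<and>
     (\<forall>t\<ge>0. AE z in M. P t (\<lambda>_. 1) z = 1) \<and>
     (\<forall>f\<in>L2 M. AE z in M. P 0 f z = f z) \<and>
     (\<forall>s\<ge>0. \<forall>t\<ge>0. \<forall>f\<in>L2 M. AE z in M. P (s + t) f z = P s (P t f) z) \<and>
     (\<forall>t\<ge>0. \<forall>f\<in>L2 M. sqnorm M (P t f) \<le> sqnorm M f) \<and>
     (\<forall>t\<ge>0. \<forall>f\<in>L2 M. (\<integral>z. P t f z \<partial>M) = (\<integral>z. f z \<partial>M)) \<and>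
     (\<forall>f\<in>L2 M. ((\<lambda>t. sqnorm M (\<lambda>z. P t f z - f z)) \<longlongrightarrow> 0) (at_right 0))"

text \<open>\<open>(u, v)\<close> belongs to the graph of the \<open>L\<^sup>2\<close> generator of \<open>P\<close>.\<close>

definition generator_graph ::
  "'a measure \<Rightarrow> (real \<Rightarrow> ('a \<Rightarrow> real) \<Rightarrow> 'a \<Rightarrow> real) \<Rightarrow> ('a \<Rightarrow> real) \<Rightarrow> ('a \<Rightarrow> real) \<Rightarrow> bool" where
  "generator_graph M P u v \<longleftrightarrow> u \<in> L2 M \<and> v \<in> L2 M \<and>
     ((\<lambda>h. sqnorm M (\<lambda>z. (P h u z - u z) / h - v z)) \<longlongrightarrow> 0) (at_right 0)"

definition dense_in_L2 :: "'a measure \<Rightarrow> ('a \<Rightarrow> real) set \<Rightarrow> bool" where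
  "dense_in_L2 M D \<longleftrightarrow> D \<subseteq> L2 M \<and>
     (\<forall>u\<in>L2 M. \<forall>e>0. \<exists>f\<in>D. sqnorm M (\<lambda>z. f z - u z) < e)"

text \<open>\<open>D\<close> is a linear space on which the generator of \<open>P\<close> is given by the operator \<open>A\<close>,
  and which is dense in the domain of the generator for the graph norm.\<close>

definition core_of ::
  "'a measure \<Rightarrow> (real \<Rightarrow> ('a \<Rightarrow> real) \<Rightarrow> 'a \<Rightarrow> real) \<Rightarrow>
   (('a \<Rightarrow> real) \<Rightarrow> 'a \<Rightarrow> real) \<Rightarrow> ('a \<Rightarrow> real) set \<Rightarrow> bool" where
  "core_of M P A D \<longleftrightarrow>
     (\<lambda>_. 0) \<in> D \<and>
     (\<forall>f\<in>D. \<forall>g\<in>D. \<forall>c. (\<lambda>z. c * f z + g z) \<in> D) \<and>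
     (\<forall>f\<in>D. generator_graph M P f (A f)) \<and>
     (\<forall>u v. generator_graph M P u v \<longrightarrow>
        (\<forall>e>0. \<exists>f\<in>D. sqnorm M (\<lambda>z. f z - u z) < e \<and> sqnorm M (\<lambda>z. A f z - v z) < e))"


section \<open>The telegraph process\<close>

text \<open>The state space is \<open>\<real> \<times> {-1, 1}\<close>, embedded in the type \<^typ>\<open>real \<times> real\<close>; values of
  functions at other points are irrelevant.\<close>

definition dx :: "(real \<times> real \<Rightarrow> real) \<Rightarrow> real \<times> real \<Rightarrow> real" where
  "dx f = (\<lambda>(x, y). deriv (\<lambda>x'. f (x', y)) x)"

definition telegraph_gen ::
  "(real \<Rightarrow> real \<Rightarrow> real) \<Rightarrow> (real \<times> real \<Rightarrow> real) \<Rightarrow> real \<times> real \<Rightarrow> real" where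
  "telegraph_gen a f = (\<lambda>(x, y). y * dx f (x, y) + a x y * (f (x, -y) - f (x, y)))"

definition potential :: "(real \<Rightarrow> real \<Rightarrow> real) \<Rightarrow> real \<Rightarrow> real" where
  "potential a x = (LBINT z=0..x. a z 1 - a z (-1))"

definition mu1 :: "(real \<Rightarrow> real \<Rightarrow> real) \<Rightarrow> real measure" where
  "mu1 a = density lborel
     (\<lambda>x. ennreal (exp (- potential a x) / (\<integral>z. exp (- potential a z) \<partial>lborel)))"

definition mu :: "(real \<Rightarrow> real \<Rightarrow> real) \<Rightarrow> (real \<times> real) measure" where
  "mu a = mu1 a \<Otimes>\<^sub>M uniform_count_measure {-1, 1}"

text \<open>The process is built from independent standard exponential clocks.  Starting from
  \<open>(x, y)\<close>, it moves along \<open>x + s * y\<close> and the velocity flips as soon as the accumulated rate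
  \<open>\<integral>\<^sub>0\<^sup>t a (x + s * y) y ds\<close> reaches the current clock \<open>e\<close>, so that the waiting time has
  hazard rate \<open>a\<close> along the path.  The waiting time is infinite if this never happens.\<close>

definition clocks :: "(nat \<Rightarrow> real) measure" where
  "clocks = PiM UNIV (\<lambda>_. density lborel (\<lambda>e. ennreal (exponential_density 1 e)))"

definition waiting_time ::
  "(real \<Rightarrow> real \<Rightarrow> real) \<Rightarrow> real \<times> real \<Rightarrow> real \<Rightarrow> ereal" where
  "waiting_time a = (\<lambda>(x, y) e.
     Inf (ereal ` {t. 0 \<le> t \<and> e \<le> (LBINT s=0..t. a (x + s * y) y)}))"

text \<open>Time of the \<open>n\<close>-th jump and state right after it; the state is irrelevant if the time is
  infinite.\<close>

primrec jump_chain ::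
  "(real \<Rightarrow> real \<Rightarrow> real) \<Rightarrow> real \<times> real \<Rightarrow> (nat \<Rightarrow> real) \<Rightarrow> nat \<Rightarrow> ereal \<times> (real \<times> real)" where
  "jump_chain a z \<omega> 0 = (0, z)"
| "jump_chain a z \<omega> (Suc n) =
     (case jump_chain a z \<omega> n of (T, (x, y)) \<Rightarrow>
        let w = waiting_time a (x, y) (\<omega> n) in (T + w, (x + y * real_of_ereal w, -y)))"

definition num_jumps ::
  "(real \<Rightarrow> real \<Rightarrow> real) \<Rightarrow> real \<times> real \<Rightarrow> (nat \<Rightarrow> real) \<Rightarrow> real \<Rightarrow> nat" where
  "num_jumps a z \<omega> t = card {n. fst (jump_chain a z \<omega> (Suc n)) \<le> ereal t}"

definition telegraph_process ::
  "(real \<Rightarrow> real \<Rightarrow> real) \<Rightarrow> real \<times> real \<Rightarrow> (nat \<Rightarrow> real) \<Rightarrow> real \<Rightarrow> real \<times> real" where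
  "telegraph_process a z \<omega> t =
     (case jump_chain a z \<omega> (num_jumps a z \<omega> t) of (T, (x, y)) \<Rightarrow>
        (x + y * (t - real_of_ereal T), y))"

definition telegraph_semigroup ::
  "(real \<Rightarrow> real \<Rightarrow> real) \<Rightarrow> real \<Rightarrow> (real \<times> real \<Rightarrow> real) \<Rightarrow> real \<times> real \<Rightarrow> real" where
  "telegraph_semigroup a t f z = (\<integral>\<omega>. f (telegraph_process a z \<omega> t) \<partial>clocks)"

end

theory Submission
  imports Defs
begin

text \<open>Let \<open>p\<close> and \<open>q\<close> be the even and the odd part of a function in the velocity. On these parts
  the generator \<open>L\<close> acts as \<open>(p, q) \<mapsto> (- \<partial>\<^sup>* q, \<partial> p - A q)\<close>, where \<open>A\<close> is the total jump rate
  \<open>a x 1 + a x (-1)\<close> and \<open>\<partial>\<^sup>*\<close> is the adjoint of \<open>\<partial>\<close> in the weighted space of the first marginal of the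
  invariant measure. The part with \<open>\<partial>\<close> is antisymmetric, so along the flow \<open>f\<^sub>t\<close> one finds
  \<open>F' = - 2 \<langle>A q, q\<rangle>\<close>: only the odd part is dissipated directly.

  The missing directions come from \<open>L f\<^sub>t\<close>, which solves the same equation. Its odd part
  \<open>\<partial> p - A q\<close> is dissipated too; together with \<open>q\<close> it controls \<open>\<partial> p\<close>, and hence \<open>p\<close> by the
  Poincare inequality. Its even part \<open>\<partial>\<^sub>t p\<close> is recovered from the cross term
  \<open>\<langle>p, \<partial>\<^sub>t p\<rangle>\<close>, whose time derivative is \<open>\<parallel>\<partial>\<^sub>t p\<parallel>\<^sup>2 - \<langle>\<partial> p, \<partial>\<^sub>t q\<rangle>\<close>. So for a large constant \<open>k\<close> the
  function \<open>H = k (\<parallel>f\<^sub>t\<parallel>\<^sup>2 + \<parallel>L f\<^sub>t\<parallel>\<^sup>2) - \<langle>p, \<partial>\<^sub>t p\<rangle>\<close> is equivalent to \<open>\<parallel>f\<^sub>t\<parallel>\<^sup>2 + \<parallel>L f\<^sub>t\<parallel>\<^sup>2\<close> and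
  satisfies \<open>H' \<le> - \<lambda> H\<close> (lemma \<open>lyapunov_dissipation\<close>).

  Since \<open>F'' = - 4 \<langle>A q, \<partial>\<^sub>t q\<rangle>\<close> is bounded by the same quantity, a multiple \<open>C H\<close> dominates
  \<open>F'' + F\<close>. The function \<open>\<nu>\<^sub>t\<close> is now defined by requiring
  \<open>F'' + 2 F' + (1 + \<nu>\<^sub>t) F = C H\<close>. As \<open>F' \<le> 0\<close>, the domination says exactly that \<open>\<nu>\<^sub>t \<ge> 0\<close>, so
  that \<open>\<eta> = 1\<close> and \<open>\<nu>\<^sub>* = 0\<close> are admissible. Dividing by \<open>F\<close> is harmless: \<open>F' \<ge> - const F\<close>, so \<open>F\<close> is
  either positive for all times or identically zero (lemma \<open>third_order_inequality\<close>).

  The identities behind this are statements about pairs \<open>(u, L u)\<close> in the graph of the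
  \<open>L\<^sup>2\<close> generator. They are continuous in the graph norm, so it is enough to integrate by parts for
  functions of the core (lemmas \<open>flux_identity_core\<close> and \<open>poincare_core\<close>). They apply to
  \<open>f\<^sub>t\<close> because the semigroup preserves the domain of its generator
  (lemma \<open>generator_graph_semigroup\<close>). Time derivatives are taken in \<open>L\<^sup>2\<close>.\<close>

section \<open>Square integrable functions and differentiable curves\<close>

lemma L2_measurable: "f \<in> L2 M \<Longrightarrow> f \<in> borel_measurable M"
  and L2_integrable_square: "f \<in> L2 M \<Longrightarrow> integrable M (\<lambda>z. (f z)\<^sup>2)"
  by (auto simp: L2_def)

lemma sqnorm_nonneg: "0 \<le> sqnorm M f"
  by (simp add: sqnorm_def)

lemma sqnorm_eq_integral_mult: "sqnorm M f = (\<integral>z. f z * f z \<partial>M)"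
  by (simp add: sqnorm_def power2_eq_square)

lemma sqnorm_cong_AE:
  assumes "f \<in> L2 M" "g \<in> L2 M" "AE z in M. f z = g z"
  shows "sqnorm M f = sqnorm M g"
  unfolding sqnorm_def using assms L2_measurable[OF assms(1)] L2_measurable[OF assms(2)]
  by (intro integral_cong_AE) auto

lemma L2_mult_integrable:
  assumes "f \<in> L2 M" "g \<in> L2 M"
  shows "integrable M (\<lambda>z. f z * g z)"
proof (rule Bochner_Integration.integrable_bound)
  show "integrable M (\<lambda>z. (f z)\<^sup>2 + (g z)\<^sup>2)"
    using assms by (simp add: L2_integrable_square)
  show "(\<lambda>z. f z * g z) \<in> borel_measurable M"
    using assms L2_measurable by measurable
  show "AE z in M. norm (f z * g z) \<le> norm ((f z)\<^sup>2 + (g z)\<^sup>2)"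
  proof (rule AE_I2)
    fix z
    have "2 * (\<bar>f z\<bar> * \<bar>g z\<bar>) \<le> (f z)\<^sup>2 + (g z)\<^sup>2"
      using sum_squares_bound[of "\<bar>f z\<bar>" "\<bar>g z\<bar>"] by (simp add: mult.assoc)
    moreover have "0 \<le> \<bar>f z\<bar> * \<bar>g z\<bar>" by simp
    ultimately show "norm (f z * g z) \<le> norm ((f z)\<^sup>2 + (g z)\<^sup>2)"
      unfolding real_norm_def abs_mult by linarith
  qed
qed

lemma L2_bounded_mult:
  assumes "f \<in> L2 M" "b \<in> borel_measurable M" "\<And>z. \<bar>b z\<bar> \<le> B"
  shows "(\<lambda>z. b z * f z) \<in> L2 M"
    and "sqnorm M (\<lambda>z. b z * f z) \<le> B\<^sup>2 * sqnorm M f"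
proof -
  have le: "(b z * f z)\<^sup>2 \<le> B\<^sup>2 * (f z)\<^sup>2" for z
  proof -
    have "(b z)\<^sup>2 \<le> B\<^sup>2"
      using assms(3)[of z] by (simp add: abs_le_square_iff[symmetric])
    then show ?thesis
      by (simp add: power_mult_distrib mult_right_mono)
  qed
  have int: "integrable M (\<lambda>z. B\<^sup>2 * (f z)\<^sup>2)"
    using L2_integrable_square[OF assms(1)] by simp
  have int': "integrable M (\<lambda>z. (b z * f z)\<^sup>2)"
    by (rule Bochner_Integration.integrable_bound[OF int])
       (use assms L2_measurable[OF assms(1)] le in auto)
  then show "(\<lambda>z. b z * f z) \<in> L2 M"
    using assms L2_measurable[OF assms(1)] by (auto simp: L2_def)
  have "sqnorm M (\<lambda>z. b z * f z) \<le> (\<integral>z. B\<^sup>2 * (f z)\<^sup>2 \<partial>M)"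
    unfolding sqnorm_def by (rule integral_mono[OF int' int le])
  then show "sqnorm M (\<lambda>z. b z * f z) \<le> B\<^sup>2 * sqnorm M f"
    by (simp add: sqnorm_def)
qed

lemma L2_cmult:
  assumes "f \<in> L2 M" shows "(\<lambda>z. c * f z) \<in> L2 M"
  by (rule L2_bounded_mult(1)[OF assms, of "\<lambda>_. c" "\<bar>c\<bar>"]) auto

lemma L2_divide:
  assumes "f \<in> L2 M" shows "(\<lambda>z. f z / c) \<in> L2 M"
  using L2_cmult[OF assms, of "1 / c"] by simp

lemma L2_add:
  assumes "f \<in> L2 M" "g \<in> L2 M" shows "(\<lambda>z. f z + g z) \<in> L2 M"
proof -
  have "integrable M (\<lambda>z. (f z)\<^sup>2 + (g z)\<^sup>2 + 2 * (f z * g z))"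
    using L2_mult_integrable[OF assms] assms by (simp add: L2_integrable_square)
  then show ?thesis
    using assms L2_measurable by (auto simp: L2_def power2_sum mult.assoc)
qed

lemma L2_diff:
  assumes "f \<in> L2 M" "g \<in> L2 M" shows "(\<lambda>z. f z - g z) \<in> L2 M"
  using L2_add[OF assms(1) L2_cmult[OF assms(2), of "-1"]] by simp

lemmas L2_intros = L2_add L2_diff L2_cmult L2_divide

lemma sqnorm_cmult: "sqnorm M (\<lambda>z. c * f z) = c\<^sup>2 * sqnorm M f"
  by (simp add: sqnorm_def power_mult_distrib)

text \<open>The integrated form of \<open>2 x y \<le> x\<^sup>2 + y\<^sup>2\<close>. The dissipation estimates use this form of
  the Cauchy-Schwarz inequality; limits of inner products use the product form below.\<close>

lemma integral_mult_add_le: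
  assumes f: "f \<in> L2 M" and g: "g \<in> L2 M"
  shows "2 * \<bar>\<integral>z. f z * g z \<partial>M\<bar> \<le> sqnorm M f + sqnorm M g"
proof -
  have le: "2 * (f z * g z) \<le> (f z)\<^sup>2 + (g z)\<^sup>2" "- ((f z)\<^sup>2 + (g z)\<^sup>2) \<le> 2 * (f z * g z)" for z
    using sum_squares_bound[of "f z" "g z"] sum_squares_bound[of "f z" "- g z"] by simp_all
  have int: "integrable M (\<lambda>z. 2 * (f z * g z))" "integrable M (\<lambda>z. (f z)\<^sup>2 + (g z)\<^sup>2)"
    using L2_mult_integrable[OF f g] L2_integrable_square[OF f] L2_integrable_square[OF g] by auto
  have "(\<integral>z. 2 * (f z * g z) \<partial>M) \<le> (\<integral>z. (f z)\<^sup>2 + (g z)\<^sup>2 \<partial>M)"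
    by (rule integral_mono[OF int le(1)])
  moreover have "(\<integral>z. - ((f z)\<^sup>2 + (g z)\<^sup>2) \<partial>M) \<le> (\<integral>z. 2 * (f z * g z) \<partial>M)"
    by (intro integral_mono le(2) Bochner_Integration.integrable_minus int)
  ultimately have "\<bar>\<integral>z. 2 * (f z * g z) \<partial>M\<bar> \<le> (\<integral>z. (f z)\<^sup>2 + (g z)\<^sup>2 \<partial>M)"
    unfolding integral_minus by linarith
  then show ?thesis
    using f g by (simp add: sqnorm_def L2_integrable_square abs_mult)
qed

lemma sqnorm_add_le:
  assumes f: "f \<in> L2 M" and g: "g \<in> L2 M"
  shows "sqnorm M (\<lambda>z. f z + g z) \<le> 2 * sqnorm M f + 2 * sqnorm M g"
proof -
  have "sqnorm M (\<lambda>z. f z + g z) = sqnorm M f + sqnorm M g + 2 * (\<integral>z. f z * g z \<partial>M)"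
    using L2_mult_integrable[OF f g] L2_integrable_square[OF f] L2_integrable_square[OF g]
    by (simp add: sqnorm_def power2_sum mult.assoc)
  then show ?thesis using integral_mult_add_le[OF f g] by linarith
qed

text \<open>Replacing \<open>f\<close> by \<open>s f\<close> in the previous inequality and optimizing over the scalar \<open>s \<ge> 0\<close>
  gives the sharp bound. If \<open>f\<close> has norm zero there is no optimal \<open>s\<close>, but a large enough \<open>s\<close> contradicts the bound unless the integral
  vanishes.\<close>

lemma Cauchy_Schwarz_L2:
  assumes f: "f \<in> L2 M" and g: "g \<in> L2 M"
  shows "\<bar>\<integral>z. f z * g z \<partial>M\<bar> \<le> sqrt (sqnorm M f * sqnorm M g)"
proof -
  have *: "2 * s * \<bar>\<integral>z. f z * g z \<partial>M\<bar> \<le> s\<^sup>2 * sqnorm M f + sqnorm M g" if "s \<ge> 0" for s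
    using integral_mult_add_le[OF L2_cmult[OF f, of s] g] that
    by (simp add: sqnorm_cmult mult.assoc abs_mult)
  have "(\<integral>z. f z * g z \<partial>M)\<^sup>2 \<le> sqnorm M f * sqnorm M g"
  proof (cases "sqnorm M f = 0")
    case True
    have "\<bar>\<integral>z. f z * g z \<partial>M\<bar> = 0"
    proof (rule ccontr)
      assume nz: "\<bar>\<integral>z. f z * g z \<partial>M\<bar> \<noteq> 0"
      have "sqnorm M g + 1 \<le> sqnorm M g"
        \<comment> \<open>this \<open>s\<close> makes the left-hand side equal to \<open>sqnorm M g + 1\<close>\<close>
        using *[of "(sqnorm M g + 1) / (2 * \<bar>\<integral>z. f z * g z \<partial>M\<bar>)"] nz True sqnorm_nonneg[of M g]
        by simp
      then show False by simp
    qed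
    then show ?thesis using True by simp
  next
    case False
    then have pos: "sqnorm M f > 0" using sqnorm_nonneg[of M f] by linarith
    let ?I = "\<bar>\<integral>z. f z * g z \<partial>M\<bar>"
    have "2 * (?I / sqnorm M f) * ?I \<le> (?I / sqnorm M f)\<^sup>2 * sqnorm M f + sqnorm M g"
      by (rule *) (use pos in simp)
    also have "(?I / sqnorm M f)\<^sup>2 * sqnorm M f = (?I / sqnorm M f) * ?I"
      using pos by (simp add: power2_eq_square)
    finally have "(?I / sqnorm M f) * ?I \<le> sqnorm M g" by simp
    then show ?thesis
      using pos by (simp add: field_simps power2_eq_square flip: abs_mult)
  qed
  then show ?thesis
    by (metis real_sqrt_abs real_sqrt_le_iff)
qed

lemma inner_L2_tendsto:
  assumes lim: "((\<lambda>s. sqnorm M (\<lambda>z. u s z - u0 z)) \<longlongrightarrow> 0) F"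
    "((\<lambda>s. sqnorm M (\<lambda>z. v s z - v0 z)) \<longlongrightarrow> 0) F"
    and u: "\<forall>\<^sub>F s in F. u s \<in> L2 M" and v: "\<forall>\<^sub>F s in F. v s \<in> L2 M"
    and u0: "u0 \<in> L2 M" and v0: "v0 \<in> L2 M"
  shows "((\<lambda>s. \<integral>z. u s z * v s z \<partial>M) \<longlongrightarrow> (\<integral>z. u0 z * v0 z \<partial>M)) F"
proof -
  let ?U = "\<lambda>s. sqnorm M (\<lambda>z. u s z - u0 z)" and ?V = "\<lambda>s. sqnorm M (\<lambda>z. v s z - v0 z)"
  let ?b = "\<lambda>s. sqrt (?U s * ?V s) + sqrt (?U s * sqnorm M v0) + sqrt (sqnorm M u0 * ?V s)"
  have "\<forall>\<^sub>F s in F. norm ((\<integral>z. u s z * v s z \<partial>M) - (\<integral>z. u0 z * v0 z \<partial>M)) \<le> ?b s"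
    using u v
  proof eventually_elim
    case (elim s)
    note du = L2_diff[OF elim(1) u0] and dv = L2_diff[OF elim(2) v0]
    have "(\<integral>z. u s z * v s z \<partial>M) = (\<integral>z. (u s z - u0 z) * (v s z - v0 z)
        + (u s z - u0 z) * v0 z + u0 z * (v s z - v0 z) + u0 z * v0 z \<partial>M)"
      by (rule Bochner_Integration.integral_cong) (auto simp: algebra_simps)
    also have "\<dots> = (\<integral>z. (u s z - u0 z) * (v s z - v0 z) \<partial>M) + (\<integral>z. (u s z - u0 z) * v0 z \<partial>M)
        + (\<integral>z. u0 z * (v s z - v0 z) \<partial>M) + (\<integral>z. u0 z * v0 z \<partial>M)"
      using L2_mult_integrable[OF du dv] L2_mult_integrable[OF du v0]
        L2_mult_integrable[OF u0 dv] L2_mult_integrable[OF u0 v0] by simp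
    finally show ?case
      using Cauchy_Schwarz_L2[OF du dv] Cauchy_Schwarz_L2[OF du v0] Cauchy_Schwarz_L2[OF u0 dv]
      by simp
  qed
  moreover have "(?b \<longlongrightarrow> 0) F"
    using lim by (auto intro!: tendsto_eq_intros)
  ultimately have "((\<lambda>s. (\<integral>z. u s z * v s z \<partial>M) - (\<integral>z. u0 z * v0 z \<partial>M)) \<longlongrightarrow> 0) F"
    by (rule Lim_null_comparison)
  then show ?thesis by (simp add: Lim_null[symmetric])
qed

text \<open>One-sided at \<open>0\<close>, because semigroups are only defined for nonnegative times.\<close>

definition L2_derivative_at ::
  "'a measure \<Rightarrow> (real \<Rightarrow> 'a \<Rightarrow> real) \<Rightarrow> ('a \<Rightarrow> real) \<Rightarrow> real \<Rightarrow> bool" where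
  "L2_derivative_at M u u' t \<longleftrightarrow>
     ((\<lambda>s. sqnorm M (\<lambda>z. (u s z - u t z) / (s - t) - u' z)) \<longlongrightarrow> 0) (at t within {0..})"

lemma eventually_nonneg_within: "\<forall>\<^sub>F s in at t within {0..}. (0::real) \<le> s"
  by (simp add: eventually_at_filter)

lemma L2_derivative_at_imp_continuous:
  assumes d: "L2_derivative_at M u u' t" and u: "\<And>s. s \<ge> 0 \<Longrightarrow> u s \<in> L2 M" "u' \<in> L2 M"
    and t: "t \<ge> 0"
  shows "((\<lambda>s. sqnorm M (\<lambda>z. u s z - u t z)) \<longlongrightarrow> 0) (at t within {0..})"
proof -
  let ?D = "\<lambda>s z. (u s z - u t z) / (s - t) - u' z"
  have "\<forall>\<^sub>F s in at t within {0..}.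
      norm (sqnorm M (\<lambda>z. u s z - u t z)) \<le> (s - t)\<^sup>2 * (2 * sqnorm M (?D s) + 2 * sqnorm M u')"
    using eventually_nonneg_within eventually_neq_at_within[of t t "{0..}"]
  proof eventually_elim
    case (elim s)
    have "sqnorm M (\<lambda>z. u s z - u t z) = (s - t)\<^sup>2 * sqnorm M (\<lambda>z. ?D s z + u' z)"
      unfolding sqnorm_cmult[symmetric] using elim by simp
    also have "\<dots> \<le> (s - t)\<^sup>2 * (2 * sqnorm M (?D s) + 2 * sqnorm M u')"
      using elim t u by (intro mult_left_mono sqnorm_add_le L2_intros) auto
    finally show ?case by (simp add: sqnorm_nonneg)
  qed
  moreover have "((\<lambda>s. (s - t)\<^sup>2 * (2 * sqnorm M (?D s) + 2 * sqnorm M u')) \<longlongrightarrow> 0) (at t within {0..})"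
    using d unfolding L2_derivative_at_def by (auto intro!: tendsto_eq_intros)
  ultimately show ?thesis by (rule Lim_null_comparison)
qed

text \<open>The product rule: the difference quotient of the inner product is the inner product of the
  difference quotient of \<open>u\<close> with \<open>v s\<close> plus that of \<open>u t\<close> with the difference quotient of \<open>v\<close>, and
  \<open>v s\<close> converges to \<open>v t\<close>.\<close>

lemma inner_L2_has_derivative:
  assumes du: "L2_derivative_at M u u' t" and dv: "L2_derivative_at M v v' t"
    and u: "\<And>s. s \<ge> 0 \<Longrightarrow> u s \<in> L2 M" "u' \<in> L2 M"
    and v: "\<And>s. s \<ge> 0 \<Longrightarrow> v s \<in> L2 M" "v' \<in> L2 M"
    and t: "t \<ge> 0"
  shows "((\<lambda>s. \<integral>z. u s z * v s z \<partial>M) has_real_derivative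
           (\<integral>z. u' z * v t z \<partial>M) + (\<integral>z. u t z * v' z \<partial>M)) (at t within {0..})"
proof -
  let ?Du = "\<lambda>s z. (u s z - u t z) / (s - t)" and ?Dv = "\<lambda>s z. (v s z - v t z) / (s - t)"
  have evL2: "\<forall>\<^sub>F s in at t within {0..}. P s" if "\<And>s. s \<ge> 0 \<Longrightarrow> P s" for P :: "real \<Rightarrow> bool"
    using eventually_nonneg_within by (rule eventually_mono) (rule that)
  have "((\<lambda>s. \<integral>z. ?Du s z * v s z \<partial>M) \<longlongrightarrow> (\<integral>z. u' z * v t z \<partial>M)) (at t within {0..})"
    using du L2_derivative_at_imp_continuous[OF dv v t] u v t
    by (intro inner_L2_tendsto evL2) (auto simp: L2_derivative_at_def intro!: L2_intros)
  moreover have "((\<lambda>s. \<integral>z. u t z * ?Dv s z \<partial>M) \<longlongrightarrow> (\<integral>z. u t z * v' z \<partial>M)) (at t within {0..})"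
    using dv u v t
    by (intro inner_L2_tendsto evL2) (auto simp: L2_derivative_at_def sqnorm_def intro!: L2_intros)
  ultimately have "((\<lambda>s. (\<integral>z. ?Du s z * v s z \<partial>M) + (\<integral>z. u t z * ?Dv s z \<partial>M)) \<longlongrightarrow>
      (\<integral>z. u' z * v t z \<partial>M) + (\<integral>z. u t z * v' z \<partial>M)) (at t within {0..})"
    by (rule tendsto_add)
  moreover have "\<forall>\<^sub>F s in at t within {0..}.
      (\<integral>z. ?Du s z * v s z \<partial>M) + (\<integral>z. u t z * ?Dv s z \<partial>M) =
      ((\<integral>z. u s z * v s z \<partial>M) - (\<integral>z. u t z * v t z \<partial>M)) / (s - t)"
    using eventually_nonneg_within
  proof eventually_elim
    case (elim s)
    have "(\<integral>z. ?Du s z * v s z \<partial>M) + (\<integral>z. u t z * ?Dv s z \<partial>M)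
        = (\<integral>z. ?Du s z * v s z + u t z * ?Dv s z \<partial>M)"
      using elim t u v
      by (intro Bochner_Integration.integral_add[symmetric] L2_mult_integrable L2_intros)
    also have "\<dots> = (\<integral>z. (u s z * v s z - u t z * v t z) / (s - t) \<partial>M)"
      by (rule Bochner_Integration.integral_cong) (auto simp: field_simps diff_divide_distrib)
    also have "\<dots> = ((\<integral>z. u s z * v s z \<partial>M) - (\<integral>z. u t z * v t z \<partial>M)) / (s - t)"
      using L2_mult_integrable[OF u(1)[OF elim] v(1)[OF elim]]
        L2_mult_integrable[OF u(1)[OF t] v(1)[OF t]] by simp
    finally show ?case .
  qed
  ultimately show ?thesis
    unfolding has_field_derivative_iff by (rule Lim_transform_eventually)
qed

section \<open>Generators of Markov semigroups\<close>

lemma generator_graph_L2: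
  "generator_graph M P u v \<Longrightarrow> u \<in> L2 M" "generator_graph M P u v \<Longrightarrow> v \<in> L2 M"
  by (auto simp: generator_graph_def)

context
  fixes M :: "'a measure" and P :: "real \<Rightarrow> ('a \<Rightarrow> real) \<Rightarrow> 'a \<Rightarrow> real"
  assumes P: "markov_semigroup M P"
begin

lemma semigroup_L2: "0 \<le> t \<Longrightarrow> f \<in> L2 M \<Longrightarrow> P t f \<in> L2 M"
  and semigroup_lincomb: "0 \<le> t \<Longrightarrow> f \<in> L2 M \<Longrightarrow> g \<in> L2 M \<Longrightarrow>
        AE z in M. P t (\<lambda>w. c * f w + g w) z = c * P t f z + P t g z"
  and semigroup_one: "0 \<le> t \<Longrightarrow> AE z in M. P t (\<lambda>_. 1) z = 1"
  and semigroup_zero: "f \<in> L2 M \<Longrightarrow> AE z in M. P 0 f z = f z"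
  and semigroup_add: "0 \<le> s \<Longrightarrow> 0 \<le> t \<Longrightarrow> f \<in> L2 M \<Longrightarrow> AE z in M. P (s + t) f z = P s (P t f) z"
  and semigroup_contraction: "0 \<le> t \<Longrightarrow> f \<in> L2 M \<Longrightarrow> sqnorm M (P t f) \<le> sqnorm M f"
  and semigroup_integral: "0 \<le> t \<Longrightarrow> f \<in> L2 M \<Longrightarrow> (\<integral>z. P t f z \<partial>M) = (\<integral>z. f z \<partial>M)"
  and semigroup_continuous_0: "f \<in> L2 M \<Longrightarrow> ((\<lambda>t. sqnorm M (\<lambda>z. P t f z - f z)) \<longlongrightarrow> 0) (at_right 0)"
  using P unfolding markov_semigroup_def by (elim conjE, simp)+

lemma semigroup_diff:
  assumes t: "0 \<le> t" and f: "f \<in> L2 M" and g: "g \<in> L2 M"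
  shows "AE z in M. P t (\<lambda>w. f w - g w) z = P t f z - P t g z"
  using semigroup_lincomb[OF t g f, of "-1"] by simp

lemma semigroup_cmult:
  assumes t: "0 \<le> t" and f: "f \<in> L2 M"
  shows "AE z in M. P t (\<lambda>w. c * f w) z = c * P t f z"
proof -
  have "(\<lambda>w. (c - 1) * f w + f w) = (\<lambda>w. c * f w)" by (simp add: algebra_simps)
  moreover have "(c - 1) * P t f z + P t f z = c * P t f z" for z by (simp add: algebra_simps)
  ultimately show ?thesis using semigroup_lincomb[OF t f f, of "c - 1"] by simp
qed

text \<open>The error of the difference quotient at time \<open>t\<close> is the image under \<open>P t\<close> of the error at
  time \<open>0\<close>. Contractivity then transports every estimate at time \<open>0\<close> to later times.\<close>

lemma semigroup_difference_quotient:
  assumes t: "0 \<le> t" and h: "h > 0" and u: "u \<in> L2 M" and v: "v \<in> L2 M"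
  shows "AE z in M. P t (\<lambda>w. (P h u w - u w) / h - v w) z
           = (P (t + h) u z - P t u z) / h - P t v z"
proof -
  have Pu: "P h u \<in> L2 M" using h u by (intro semigroup_L2) auto
  have "AE z in M. P t (\<lambda>w. (1 / h) * (P h u w - u w) - v w) z
           = P t (\<lambda>w. (1 / h) * (P h u w - u w)) z - P t v z"
    using Pu u v t by (intro semigroup_diff L2_intros)
  moreover have "AE z in M. P t (\<lambda>w. (1 / h) * (P h u w - u w)) z = (1 / h) * P t (\<lambda>w. P h u w - u w) z"
    using Pu u t by (intro semigroup_cmult L2_intros)
  moreover have "AE z in M. P t (\<lambda>w. P h u w - u w) z = P t (P h u) z - P t u z"
    by (rule semigroup_diff[OF t Pu u])
  moreover have "AE z in M. P (t + h) u z = P t (P h u) z"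
    using t h u by (intro semigroup_add) auto
  ultimately show ?thesis
    by eventually_elim simp
qed

lemma generator_graph_semigroup:
  assumes G: "generator_graph M P u v" and t: "0 \<le> t"
  shows "generator_graph M P (P t u) (P t v)"
proof -
  note u = generator_graph_L2(1)[OF G] and v = generator_graph_L2(2)[OF G]
  have "sqnorm M (\<lambda>z. (P h (P t u) z - P t u z) / h - P t v z)
          \<le> sqnorm M (\<lambda>z. (P h u z - u z) / h - v z)" if h: "h > 0" for h
  proof -
    have "AE z in M. P (t + h) u z = P h (P t u) z"
      using semigroup_add[of h t u] h t u by (simp add: add.commute)
    then have "sqnorm M (\<lambda>z. (P h (P t u) z - P t u z) / h - P t v z)
        = sqnorm M (P t (\<lambda>w. (P h u w - u w) / h - v w))"
      using semigroup_difference_quotient[OF t h u v] h t u v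
      by (intro sqnorm_cong_AE semigroup_L2 L2_intros) auto
    also have "\<dots> \<le> sqnorm M (\<lambda>z. (P h u z - u z) / h - v z)"
      using h t u v by (intro semigroup_contraction L2_intros semigroup_L2) auto
    finally show ?thesis .
  qed
  then have "\<forall>\<^sub>F h in at_right 0. norm (sqnorm M (\<lambda>z. (P h (P t u) z - P t u z) / h - P t v z))
          \<le> sqnorm M (\<lambda>z. (P h u z - u z) / h - v z)"
    by (simp add: sqnorm_nonneg eventually_at_right_less[THEN eventually_mono])
  moreover have "((\<lambda>h. sqnorm M (\<lambda>z. (P h u z - u z) / h - v z)) \<longlongrightarrow> 0) (at_right 0)"
    using G unfolding generator_graph_def by blast
  ultimately have "((\<lambda>h. sqnorm M (\<lambda>z. (P h (P t u) z - P t u z) / h - P t v z)) \<longlongrightarrow> 0) (at_right 0)"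
    by (rule Lim_null_comparison)
  then show ?thesis
    using u v t by (auto simp: generator_graph_def intro: semigroup_L2)
qed

text \<open>On the left of \<^term>\<open>t\<close> the difference quotient equals \<^term>\<open>P s\<close> applied to the one at
  time \<open>0\<close>, with \<^term>\<open>s < t\<close> instead of \<^term>\<open>t\<close>; the error is absorbed by strong
  continuity at \<open>0\<close>.\<close>

lemma semigroup_L2_derivative:
  assumes G: "generator_graph M P u v" and t: "0 \<le> t"
  shows "L2_derivative_at M (\<lambda>s. P s u) (P t v) t"
proof -
  note u = generator_graph_L2(1)[OF G] and v = generator_graph_L2(2)[OF G]
  let ?q = "\<lambda>h z. (P h u z - u z) / h - v z" and ?c = "\<lambda>h z. P h v z - v z"
  let ?D = "\<lambda>s z. (P s u z - P t u z) / (s - t) - P t v z"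
  let ?b = "\<lambda>h. 2 * sqnorm M (?q h) + 2 * sqnorm M (?c h)"
  have qL2: "?q h \<in> L2 M" and cL2: "?c h \<in> L2 M" if "h > 0" for h
    using u v that by (auto intro!: L2_intros semigroup_L2)
  have bound: "sqnorm M (?D s) \<le> ?b \<bar>s - t\<bar>" if s: "s \<ge> 0" "s \<noteq> t" for s
  proof (cases "s > t")
    case True
    then have h: "s - t > 0" by simp
    have "sqnorm M (?D s) = sqnorm M (P t (?q (s - t)))"
      using semigroup_difference_quotient[OF t h u v] h t u v s
      by (intro sqnorm_cong_AE semigroup_L2 L2_intros) auto
    also have "\<dots> \<le> sqnorm M (?q (s - t))"
      using h t by (intro semigroup_contraction qL2)
    finally show ?thesis
      using True sqnorm_nonneg[of M "?q (s - t)"] sqnorm_nonneg[of M "?c (s - t)"] by simp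
  next
    case False
    with s have h: "t - s > 0" by simp
    have flip: "(P s u z - P t u z) / (s - t) = (P t u z - P s u z) / (t - s)" for z
      by (metis minus_diff_eq minus_divide_divide)
    have 1: "AE z in M. P s (?q (t - s)) z = (P t u z - P s u z) / (t - s) - P s v z"
      using semigroup_difference_quotient[OF s(1) h u v] by simp
    have 2: "AE z in M. P s (?c (t - s)) z = P s (P (t - s) v) z - P s v z"
      using h s v by (intro semigroup_diff semigroup_L2) auto
    have 3: "AE z in M. P t v z = P s (P (t - s) v) z"
      using semigroup_add[of s "t - s" v] h s v by simp
    have "sqnorm M (?D s) = sqnorm M (\<lambda>z. P s (?q (t - s)) z + - 1 * P s (?c (t - s)) z)"
      using 1 2 3 h t u v s
      by (intro sqnorm_cong_AE L2_intros semigroup_L2) (auto simp: flip)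
    also have "\<dots> \<le> 2 * sqnorm M (P s (?q (t - s))) + 2 * sqnorm M (\<lambda>z. - 1 * P s (?c (t - s)) z)"
      using h u v s by (intro sqnorm_add_le L2_intros semigroup_L2) auto
    also have "\<dots> = 2 * sqnorm M (P s (?q (t - s))) + 2 * sqnorm M (P s (?c (t - s)))"
      by (simp add: sqnorm_def)
    also have "\<dots> \<le> ?b (t - s)"
      using h s by (intro add_mono mult_left_mono semigroup_contraction qL2 cL2) auto
    finally show ?thesis using h by simp
  qed
  have "(?b \<longlongrightarrow> 0) (at_right 0)"
    using G semigroup_continuous_0[OF v] unfolding generator_graph_def
    by (auto intro!: tendsto_eq_intros)
  moreover have "filterlim (\<lambda>s. \<bar>s - t\<bar>) (at_right 0) (at t within {0..})"
    unfolding filterlim_at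
    by (auto simp: eventually_at_filter intro!: tendsto_eq_intros)
  ultimately have lim: "((\<lambda>s. ?b \<bar>s - t\<bar>) \<longlongrightarrow> 0) (at t within {0..})"
    by (rule filterlim_compose)
  have "\<forall>\<^sub>F s in at t within {0..}. norm (sqnorm M (?D s)) \<le> ?b \<bar>s - t\<bar>"
    using bound by (auto simp: eventually_at_filter sqnorm_nonneg)
  then show ?thesis
    unfolding L2_derivative_at_def using lim by (rule Lim_null_comparison)
qed

text \<open>Constants are invariant, so that a function can be centred without leaving the domain of the
  generator. The product
  \<open>c * 1\<close> exhibits the function as a linear combination of \<open>1\<close> and \<open>u\<close>.\<close>

lemma generator_graph_add_const:
  assumes G: "generator_graph M P u v" and c: "(\<lambda>_. 1) \<in> L2 M"
  shows "generator_graph M P (\<lambda>z. c * 1 + u z) v"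
proof -
  note u = generator_graph_L2(1)[OF G] and v = generator_graph_L2(2)[OF G]
  have cu: "(\<lambda>z. c * 1 + u z) \<in> L2 M"
    using u assms(2) by (intro L2_intros)
  have "sqnorm M (\<lambda>z. (P h (\<lambda>z. c * 1 + u z) z - (c * 1 + u z)) / h - v z)
      = sqnorm M (\<lambda>z. (P h u z - u z) / h - v z)" if h: "h > 0" for h
  proof (rule sqnorm_cong_AE)
    show "AE z in M. (P h (\<lambda>z. c * 1 + u z) z - (c * 1 + u z)) / h - v z = (P h u z - u z) / h - v z"
      using semigroup_lincomb[of h "\<lambda>_. 1" u c] semigroup_one[of h] h c u by force
  qed (use h u v cu semigroup_L2[of h] in \<open>auto intro!: L2_intros\<close>)
  then have ev: "\<forall>\<^sub>F h in at_right 0. sqnorm M (\<lambda>z. (P h u z - u z) / h - v z) =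
      sqnorm M (\<lambda>z. (P h (\<lambda>z. c * 1 + u z) z - (c * 1 + u z)) / h - v z)"
    by (simp add: eventually_at_filter)
  have "((\<lambda>h. sqnorm M (\<lambda>z. (P h (\<lambda>z. c * 1 + u z) z - (c * 1 + u z)) / h - v z)) \<longlongrightarrow> 0) (at_right 0)"
    by (rule Lim_transform_eventually[OF _ ev]) (use G in \<open>simp add: generator_graph_def\<close>)
  then show ?thesis using cu v by (simp add: generator_graph_def)
qed

end

lemma core_approximation:
  assumes core: "core_of M P A D" and G: "generator_graph M P u v"
  obtains f where "\<And>n::nat. f n \<in> D"
    "(\<lambda>n. sqnorm M (\<lambda>z. f n z - u z)) \<longlonglongrightarrow> 0" "(\<lambda>n. sqnorm M (\<lambda>z. A (f n) z - v z)) \<longlonglongrightarrow> 0"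
proof -
  have "\<exists>f\<in>D. sqnorm M (\<lambda>z. f z - u z) < inverse (real (Suc n)) \<and>
               sqnorm M (\<lambda>z. A f z - v z) < inverse (real (Suc n))" for n
    using core G unfolding core_of_def by simp
  then obtain f where f: "\<And>n. f n \<in> D" "\<And>n. sqnorm M (\<lambda>z. f n z - u z) < inverse (real (Suc n))"
      "\<And>n. sqnorm M (\<lambda>z. A (f n) z - v z) < inverse (real (Suc n))"
    by metis
  have "(\<lambda>n. sqnorm M (\<lambda>z. f n z - u z)) \<longlonglongrightarrow> 0"
    by (rule tendsto_sandwich[OF _ _ tendsto_const LIMSEQ_inverse_real_of_nat])
       (auto simp: sqnorm_nonneg simp del: of_nat_Suc intro!: always_eventually less_imp_le f)
  moreover have "(\<lambda>n. sqnorm M (\<lambda>z. A (f n) z - v z)) \<longlonglongrightarrow> 0"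
    by (rule tendsto_sandwich[OF _ _ tendsto_const LIMSEQ_inverse_real_of_nat])
       (auto simp: sqnorm_nonneg simp del: of_nat_Suc intro!: always_eventually less_imp_le f)
  ultimately show ?thesis using f(1) that by blast
qed

section \<open>Integrable functions with integrable derivative\<close>

lemma set_integral_derivative:
  fixes h h' :: "real \<Rightarrow> real"
  assumes d: "\<And>x. (h has_real_derivative h' x) (at x)"
    and ih': "integrable lborel h'" and "a \<le> b"
  shows "(LINT x:{a..b}|lborel. h' x) = h b - h a"
proof -
  have "set_integrable lborel {a..b} h'"
    unfolding set_integrable_def using integrable_mult_indicator[OF _ ih', of "{a..b}"] by simp
  then have "(LINT x:{a..b}|lborel. h' x) = integral {a..b} h'"
    by (rule set_borel_integral_eq_integral)
  also have "\<dots> = h b - h a"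
    using d \<open>a \<le> b\<close> by (intro integral_unique fundamental_theorem_of_calculus)
      (auto simp: has_real_derivative_iff_has_vector_derivative intro: has_vector_derivative_at_within)
  finally show ?thesis .
qed

text \<open>The integral of the derivative converges, so the function has a limit, and an integrable
  function can only have the limit zero.\<close>

lemma tendsto_0_of_integrable_derivative:
  fixes h h' :: "real \<Rightarrow> real"
  assumes d: "\<And>x. (h has_real_derivative h' x) (at x)"
    and ih: "integrable lborel h" and ih': "integrable lborel h'"
  shows "(h \<longlongrightarrow> 0) at_top"
proof -
  have int: "set_integrable lborel {0..} h'"
    unfolding set_integrable_def using integrable_mult_indicator[OF _ ih', of "{0..}"] by simp
  define l where "l = h 0 + (LINT x:{0..}|lborel. h' x)"
  have eq: "h 0 + (LINT x:{0..b}|lborel. h' x) = h b" if "b \<ge> 0" for b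
    using set_integral_derivative[OF d ih' that] by simp
  have "((\<lambda>b. h 0 + (LINT x:{0..b}|lborel. h' x)) \<longlongrightarrow> l) at_top"
    unfolding l_def by (intro tendsto_intros tendsto_set_lebesgue_integral_at_top int) auto
  then have lim: "(h \<longlongrightarrow> l) at_top"
    by (rule Lim_transform_eventually)
       (rule eventually_mono[OF eventually_ge_at_top[of 0]], rule eq)
  have "l = 0"
  proof (rule ccontr)
    assume "l \<noteq> 0"
    have "((\<lambda>x. \<bar>h x\<bar>) \<longlongrightarrow> \<bar>l\<bar>) at_top"
      using lim by (rule tendsto_rabs)
    then have "\<forall>\<^sub>F x in at_top. \<bar>l\<bar> / 2 < \<bar>h x\<bar>"
      by (rule order_tendstoD) (use \<open>l \<noteq> 0\<close> in auto)
    then obtain b where b: "\<And>x. x \<ge> b \<Longrightarrow> \<bar>l\<bar> / 2 < \<bar>h x\<bar>"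
      by (auto simp: eventually_at_top_linorder)
    have "integrable lborel (indicat_real {b..})"
    proof (rule Bochner_Integration.integrable_bound)
      show "integrable lborel (\<lambda>x. 2 / \<bar>l\<bar> * h x)" using ih by simp
      have "1 \<le> \<bar>2 / \<bar>l\<bar> * h x\<bar>" if "x \<ge> b" for x
        using b[OF that] \<open>l \<noteq> 0\<close> by (simp add: abs_mult field_simps)
      then show "AE x in lborel. norm (indicat_real {b..} x) \<le> norm (2 / \<bar>l\<bar> * h x)"
        by (intro AE_I2) (simp add: indicator_def)
    qed simp
    then have "emeasure lborel {b..} \<noteq> \<infinity>"
      by (simp add: integrable_indicator_iff)
    then obtain r where r: "0 \<le> r" "emeasure lborel {b..} = ennreal r"
      by (cases "emeasure lborel {b..}") auto
    have "ennreal (r + 1) = emeasure lborel {b..b + (r + 1)}"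
      using r by simp
    also have "\<dots> \<le> emeasure lborel {b..}"
      by (rule emeasure_mono) auto
    finally have "ennreal (r + 1) \<le> ennreal r" using r by simp
    with r show False by (simp add: ennreal_le_iff)
  qed
  with lim show ?thesis by simp
qed

lemma integral_derivative_eq_0:
  fixes h h' :: "real \<Rightarrow> real"
  assumes d: "\<And>x. (h has_real_derivative h' x) (at x)"
    and ih: "integrable lborel h" and ih': "integrable lborel h'"
  shows "(\<integral>x. h' x \<partial>lborel) = 0"
proof -
  have top: "(h \<longlongrightarrow> 0) at_top"
    by (rule tendsto_0_of_integrable_derivative[OF assms])
  have "((\<lambda>x. h (- x)) \<longlongrightarrow> 0) at_top"
  proof (rule tendsto_0_of_integrable_derivative)
    show "((\<lambda>x. h (- x)) has_real_derivative - h' (- x)) (at x)" for x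
    proof -
      have "((\<lambda>x. h (- x)) has_real_derivative h' (- x) * - 1) (at x)"
        by (rule DERIV_chain2[where f = h and g = uminus, OF d]) (auto intro!: derivative_eq_intros)
      then show ?thesis by simp
    qed
    show "integrable lborel (\<lambda>x. h (- x))"
      using lborel_integrable_real_affine[OF ih, of "-1" 0] by simp
    show "integrable lborel (\<lambda>x. - h' (- x))"
      using lborel_integrable_real_affine[OF ih', of "-1" 0] by simp
  qed
  with top have "((\<lambda>x. h x - h (- x)) \<longlongrightarrow> 0) at_top"
    using tendsto_diff by fastforce
  then have "(\<lambda>n. h (real n) - h (- real n)) \<longlonglongrightarrow> 0"
    by (rule filterlim_compose[OF _ filterlim_real_sequentially])
  moreover have "(\<lambda>n. LINT x:{- real n..real n}|lborel. h' x) = (\<lambda>n. h (real n) - h (- real n))"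
    by (intro ext set_integral_derivative[OF d ih']) simp
  moreover have "(\<lambda>n. LINT x:{- real n..real n}|lborel. h' x) \<longlonglongrightarrow> (\<integral>x. h' x \<partial>lborel)"
    unfolding set_lebesgue_integral_def
  proof (rule integral_dominated_convergence)
    show "AE x in lborel. (\<lambda>n. indicat_real {- real n..real n} x *\<^sub>R h' x) \<longlonglongrightarrow> h' x"
    proof (rule AE_I2, rule tendsto_eventually)
      fix x :: real
      obtain N where "\<bar>x\<bar> \<le> real N" using real_arch_simple by blast
      then have "indicat_real {- real n..real n} x *\<^sub>R h' x = h' x" if "n \<ge> N" for n
        using that of_nat_mono[OF that, where ?'a = real] by (auto simp: indicator_def)
      then show "\<forall>\<^sub>F n in sequentially. indicat_real {- real n..real n} x *\<^sub>R h' x = h' x"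
        by (auto simp: eventually_sequentially)
    qed
    show "integrable lborel (\<lambda>x. \<bar>h' x\<bar>)" using ih' by simp
    show "AE x in lborel. norm (indicat_real {- real n..real n} x *\<^sub>R h' x) \<le> \<bar>h' x\<bar>" for n
      by (auto simp: indicator_def)
  qed (use ih' in auto)
  ultimately show ?thesis
    using LIMSEQ_unique by metis
qed

text \<open>The set where two continuous functions differ is open, and a nonempty open set is not a null
  set.\<close>

lemma continuous_AE_eq_imp_eq:
  fixes f g :: "real \<Rightarrow> real"
  assumes f: "continuous_on UNIV f" and g: "continuous_on UNIV g" and ae: "AE x in lborel. f x = g x"
  shows "f = g"
proof -
  have "open {x. f x \<noteq> g x}"
    using open_Collect_neq[OF f g] .
  moreover have "negligible {x. f x \<noteq> g x}"
  proof -
    have "{x. f x \<noteq> g x} \<in> sets borel" using \<open>open _\<close> by simp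
    with ae have "{x. f x \<noteq> g x} \<in> null_sets lborel"
      by (subst (asm) AE_iff_null) auto
    then show ?thesis
      by (simp add: negligible_iff_null_sets null_sets_completionI)
  qed
  ultimately have "{x. f x \<noteq> g x} = {}"
    using open_not_negligible by blast
  then show ?thesis by auto
qed

section \<open>The invariant measure and the even and odd parts\<close>

definition even_part :: "(real \<times> real \<Rightarrow> real) \<Rightarrow> real \<Rightarrow> real" where
  "even_part u x = (u (x, 1) + u (x, -1)) / 2"

definition odd_part :: "(real \<times> real \<Rightarrow> real) \<Rightarrow> real \<Rightarrow> real" where
  "odd_part u x = (u (x, 1) - u (x, -1)) / 2"

text \<open>The bounds \<open>\<alpha>\<close> and \<open>\<beta>\<close> on the total rate measure how strongly the odd part is damped.\<close>

locale telegraph_rates =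
  fixes a :: "real \<Rightarrow> real \<Rightarrow> real" and \<alpha> \<beta> :: real
  assumes rate_pos: "y \<in> {-1, 1} \<Longrightarrow> 0 < a x y"
    and rate_continuous: "y \<in> {-1, 1} \<Longrightarrow> continuous_on UNIV (\<lambda>x. a x y)"
    and total_rate_bounds: "0 < \<alpha>" "\<alpha> \<le> a x 1 + a x (-1)" "a x 1 + a x (-1) \<le> \<beta>"
    and potential_integrable: "integrable lborel (\<lambda>x. exp (- potential a x))"
begin

abbreviation total_rate :: "real \<Rightarrow> real" where
  "total_rate x \<equiv> a x 1 + a x (-1)"

lemma potential_derivative: "(potential a has_real_derivative a x 1 - a x (-1)) (at x)"
proof -
  define l r where "l = min x 0 - 1" and "r = max x 0 + 1"
  have "((\<lambda>u. LBINT z=0..u. a z 1 - a z (-1)) has_vector_derivative a x 1 - a x (-1))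
      (at x within {l..r})"
    by (rule interval_integral_FTC2[of l 0 r, unfolded zero_ereal_def[symmetric]])
       (auto simp: l_def r_def intro!: continuous_intros continuous_on_subset[OF rate_continuous])
  moreover have "at x within {l..r} = at x"
    by (rule at_within_interior) (auto simp: l_def r_def)
  ultimately show ?thesis
    by (simp add: has_real_derivative_iff_has_vector_derivative potential_def[abs_def])
qed

lemma total_rate_measurable: "total_rate \<in> borel_measurable borel"
  using rate_continuous by (intro borel_measurable_continuous_onI continuous_intros) auto

lemma potential_measurable: "potential a \<in> borel_measurable borel"
  by (intro borel_measurable_continuous_onI continuous_at_imp_continuous_on ballI
        DERIV_isCont[OF potential_derivative])

definition partition_function where "partition_function = (\<integral>z. exp (- potential a z) \<partial>lborel)"

lemma partition_function_pos: "0 < partition_function"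
proof -
  have "partition_function \<noteq> 0"
  proof
    assume "partition_function = 0"
    then have "AE x in lborel. exp (- potential a x) = 0"
      using integral_nonneg_eq_0_iff_AE[OF potential_integrable] by (simp add: partition_function_def)
    then have "AE x in (lborel :: real measure). False" by simp
    then have "ae_filter (lborel :: real measure) = bot"
      by (simp add: trivial_limit_def)
    then show False
      by (simp add: ae_filter_eq_bot_iff)
  qed
  moreover have "0 \<le> partition_function" by (simp add: partition_function_def)
  ultimately show ?thesis by simp
qed

lemma mu1_eq: "mu1 a = density lborel (\<lambda>x. ennreal (exp (- potential a x) / partition_function))"
  by (simp add: mu1_def partition_function_def)

lemma sets_mu1 [measurable_cong, simp]: "sets (mu1 a) = sets borel"
  and space_mu1 [simp]: "space (mu1 a) = UNIV"
  by (simp_all add: mu1_def)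

lemma measurable_mu1: "borel_measurable (mu1 a) = borel_measurable borel"
  by (rule measurable_cong_sets) simp_all

lemma integral_mu1:
  assumes "f \<in> borel_measurable borel"
  shows "(\<integral>x. f x \<partial>mu1 a) = (\<integral>x. exp (- potential a x) / partition_function * f x \<partial>lborel)"
    and "integrable (mu1 a) f \<longleftrightarrow> integrable lborel (\<lambda>x. exp (- potential a x) / partition_function * f x)"
proof -
  have f: "f \<in> borel_measurable lborel"
    using assms by simp
  have g: "(\<lambda>x. exp (- potential a x) / partition_function) \<in> borel_measurable lborel"
    using potential_measurable by simp
  have nn: "AE x in lborel. 0 \<le> exp (- potential a x) / partition_function"
    using partition_function_pos by simp
  show "(\<integral>x. f x \<partial>mu1 a) = (\<integral>x. exp (- potential a x) / partition_function * f x \<partial>lborel)"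
    unfolding mu1_eq using integral_density[OF f g nn] by simp
  show "integrable (mu1 a) f \<longleftrightarrow> integrable lborel (\<lambda>x. exp (- potential a x) / partition_function * f x)"
    unfolding mu1_eq using integrable_density[OF f g nn] by simp
qed

lemma prob_space_mu1: "prob_space (mu1 a)"
proof
  have "emeasure (mu1 a) (space (mu1 a)) = (\<integral>\<^sup>+x. ennreal (exp (- potential a x) / partition_function) \<partial>lborel)"
    unfolding mu1_eq using potential_measurable by (subst emeasure_density) auto
  also have "\<dots> = ennreal (\<integral>x. exp (- potential a x) / partition_function \<partial>lborel)"
    using potential_integrable partition_function_pos by (intro nn_integral_eq_integral) auto
  also have "\<dots> = 1"
    using partition_function_pos by (simp add: partition_function_def[symmetric])
  finally show "emeasure (mu1 a) (space (mu1 a)) = 1" .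
qed

sublocale mu1: prob_space "mu1 a"
  by (rule prob_space_mu1)

sublocale sign: prob_space "uniform_count_measure {-1, 1 :: real}"
  by (rule prob_space_uniform_count_measure) auto

sublocale mu: pair_prob_space "mu1 a" "uniform_count_measure {-1, 1 :: real}" ..

lemma section_measurable:
  assumes "u \<in> borel_measurable (mu a)" "y \<in> {-1, 1}"
  shows "(\<lambda>x. u (x, y)) \<in> borel_measurable (mu1 a)"
proof -
  have "(\<lambda>x. (x, y)) \<in> mu1 a \<rightarrow>\<^sub>M mu a"
    unfolding mu_def using assms(2)
    by (intro measurable_Pair measurable_const) (simp_all add: space_uniform_count_measure)
  then show ?thesis
    using assms(1) by (rule measurable_compose)
qed

lemma integral_mu:
  fixes h :: "real \<times> real \<Rightarrow> real"
  assumes "integrable (mu a) h"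
  shows "integrable (mu1 a) (\<lambda>x. (h (x, 1) + h (x, -1)) / 2)"
    and "(\<integral>w. h w \<partial>mu a) = (\<integral>x. (h (x, 1) + h (x, -1)) / 2 \<partial>mu1 a)"
proof -
  have eq: "(\<integral>y. h (x, y) \<partial>uniform_count_measure {-1, 1}) = (h (x, 1) + h (x, -1)) / 2" for x
    by (subst integral_uniform_count_measure) auto
  show "integrable (mu1 a) (\<lambda>x. (h (x, 1) + h (x, -1)) / 2)"
    using mu.integrable_fst'[OF assms[unfolded mu_def]] by (simp only: eq)
  show "(\<integral>w. h w \<partial>mu a) = (\<integral>x. (h (x, 1) + h (x, -1)) / 2 \<partial>mu1 a)"
    using mu.integral_fst'[OF assms[unfolded mu_def]] by (simp only: eq mu_def)
qed

lemma sections_L2: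
  assumes u: "u \<in> L2 (mu a)" and y: "y \<in> {-1, 1}"
  shows "(\<lambda>x. u (x, y)) \<in> L2 (mu1 a)"
proof -
  have m: "(\<lambda>x. u (x, y)) \<in> borel_measurable (mu1 a)"
    using u y by (intro section_measurable) (auto simp: L2_def)
  have i: "integrable (mu1 a) (\<lambda>x. 2 * (((u (x, 1))\<^sup>2 + (u (x, -1))\<^sup>2) / 2))"
    using integral_mu(1)[OF L2_integrable_square[OF u]] by (intro integrable_mult_right)
  have "integrable (mu1 a) (\<lambda>x. (u (x, y))\<^sup>2)"
    by (rule Bochner_Integration.integrable_bound[OF i]) (use m y in auto)
  with m show ?thesis by (simp add: L2_def)
qed

lemma parts_L2:
  assumes u: "u \<in> L2 (mu a)"
  shows "even_part u \<in> L2 (mu1 a)" and "odd_part u \<in> L2 (mu1 a)"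
  unfolding even_part_def[abs_def] odd_part_def[abs_def]
  by (intro L2_intros sections_L2 u; simp)+

lemma one_L2: "(\<lambda>_. 1) \<in> L2 (mu a)" "(\<lambda>_. 1) \<in> L2 (mu1 a)"
  by (simp_all add: L2_def mu_def)

text \<open>The two parts are orthogonal, because the velocity is symmetric under the invariant measure.
  This turns all computations into computations on the line.\<close>

lemma sqnorm_parts:
  assumes u: "u \<in> L2 (mu a)"
  shows "sqnorm (mu a) u = sqnorm (mu1 a) (even_part u) + sqnorm (mu1 a) (odd_part u)"
proof -
  have "sqnorm (mu a) u = (\<integral>x. ((u (x, 1))\<^sup>2 + (u (x, -1))\<^sup>2) / 2 \<partial>mu1 a)"
    unfolding sqnorm_def by (rule integral_mu(2)[OF L2_integrable_square[OF u]])
  also have "\<dots> = (\<integral>x. (even_part u x)\<^sup>2 + (odd_part u x)\<^sup>2 \<partial>mu1 a)"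
    by (rule Bochner_Integration.integral_cong)
       (auto simp: even_part_def odd_part_def power2_eq_square field_simps)
  also have "\<dots> = sqnorm (mu1 a) (even_part u) + sqnorm (mu1 a) (odd_part u)"
    unfolding sqnorm_def using parts_L2[OF u] by (simp add: L2_integrable_square)
  finally show ?thesis .
qed

lemma sqnorm_parts_le:
  assumes u: "u \<in> L2 (mu a)"
  shows "sqnorm (mu1 a) (even_part u) \<le> sqnorm (mu a) u" "sqnorm (mu1 a) (odd_part u) \<le> sqnorm (mu a) u"
  using sqnorm_parts[OF u] by (simp_all add: sqnorm_nonneg)

lemma integral_even_part:
  assumes u: "u \<in> L2 (mu a)"
  shows "(\<integral>w. u w \<partial>mu a) = (\<integral>x. even_part u x \<partial>mu1 a)"
proof -
  have "integrable (mu a) u"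
    using L2_mult_integrable[OF one_L2(1) u] by simp
  then show ?thesis by (simp add: integral_mu(2) even_part_def)
qed

text \<open>The invariant measure has a positive density on each of the two lines, so continuous functions
  are determined by their class.\<close>

lemma AE_mu_imp_eq:
  fixes f g :: "real \<times> real \<Rightarrow> real"
  assumes ae: "AE w in mu a. f w = g w" and y: "y \<in> {-1, 1}"
    and f: "continuous_on UNIV (\<lambda>x. f (x, y))" and g: "continuous_on UNIV (\<lambda>x. g (x, y))"
  shows "(\<lambda>x. f (x, y)) = (\<lambda>x. g (x, y))"
proof (rule continuous_AE_eq_imp_eq[OF f g])
  have "AE x in mu1 a. AE y in uniform_count_measure {-1, 1}. f (x, y) = g (x, y)"
    using mu.AE_pair[OF ae[unfolded mu_def]] by simp
  then have "AE x in mu1 a. f (x, y) = g (x, y)"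
  proof eventually_elim
    case (elim x)
    then show ?case
      using y unfolding uniform_count_measure_def by (subst (asm) AE_point_measure) auto
  qed
  moreover have "(\<lambda>x. ennreal (exp (- potential a x) / partition_function)) \<in> borel_measurable lborel"
    using potential_measurable by simp
  ultimately have "AE x in lborel. 0 < ennreal (exp (- potential a x) / partition_function) \<longrightarrow> f (x, y) = g (x, y)"
    unfolding mu1_eq by (simp only: AE_density)
  then show "AE x in lborel. f (x, y) = g (x, y)"
    by eventually_elim (use partition_function_pos in simp)
qed

end

section \<open>Integration by parts and coercivity on the domain of the generator\<close>

text \<open>The process enters only through its generator: \<open>P\<close> is any Markov semigroup whose generator is given by
  the telegraph operator on a core of continuously differentiable functions.\<close>

locale telegraph_core = telegraph_rates a \<alpha> \<beta>
  for a :: "real \<Rightarrow> real \<Rightarrow> real" and \<alpha> \<beta> :: real +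
  fixes P :: "real \<Rightarrow> (real \<times> real \<Rightarrow> real) \<Rightarrow> real \<times> real \<Rightarrow> real"
    and D :: "(real \<times> real \<Rightarrow> real) set" and c :: real
  assumes semigroup: "markov_semigroup (mu a) P"
    and core: "core_of (mu a) P (telegraph_gen a) D"
    and core_derivative: "f \<in> D \<Longrightarrow> y \<in> {-1, 1} \<Longrightarrow>
           ((\<lambda>x. f (x, y)) has_real_derivative dx f (x, y)) (at x)"
    and core_C1: "f \<in> D \<Longrightarrow> y \<in> {-1, 1} \<Longrightarrow> continuous_on UNIV (\<lambda>x. dx f (x, y))"
    and poincare_mu1: "poincare (mu1 a) c" and poincare_pos: "0 < c"
begin

abbreviation graph where "graph \<equiv> generator_graph (mu a) P"

abbreviation inner1 :: "(real \<Rightarrow> real) \<Rightarrow> (real \<Rightarrow> real) \<Rightarrow> real" where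
  "inner1 f g \<equiv> (\<integral>x. f x * g x \<partial>mu1 a)"

text \<open>If \<open>v\<close> is the image of \<open>u\<close> under the generator, this is the derivative of the even part of \<open>u\<close>.
  For functions outside the core it serves as the definition of that derivative in
  \<open>L\<^sup>2\<close>, and it depends continuously on the pair \<open>(u, v)\<close>.\<close>

definition gradient :: "(real \<times> real \<Rightarrow> real) \<Rightarrow> (real \<times> real \<Rightarrow> real) \<Rightarrow> real \<Rightarrow> real" where
  "gradient u v x = odd_part v x + total_rate x * odd_part u x"

lemma core_graph: "f \<in> D \<Longrightarrow> graph f (telegraph_gen a f)"
  using core unfolding core_of_def by blast

lemma total_rate_abs_le: "\<bar>total_rate x\<bar> \<le> \<beta>"
  using total_rate_bounds(1) total_rate_bounds(2,3)[of x] by linarith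

lemma weighted_L2:
  assumes "f \<in> L2 (mu1 a)"
  shows "(\<lambda>x. total_rate x * f x) \<in> L2 (mu1 a)"
    and "sqnorm (mu1 a) (\<lambda>x. total_rate x * f x) \<le> \<beta>\<^sup>2 * sqnorm (mu1 a) f"
  using L2_bounded_mult[OF assms _ total_rate_abs_le] total_rate_measurable
  by (simp_all add: measurable_mu1)

lemma graph_parts_L2:
  assumes "graph u v"
  shows "even_part u \<in> L2 (mu1 a)" "odd_part u \<in> L2 (mu1 a)"
    "even_part v \<in> L2 (mu1 a)" "odd_part v \<in> L2 (mu1 a)"
  using assms by (auto simp: generator_graph_def intro: parts_L2)

lemma gradient_L2:
  assumes "graph u v"
  shows "gradient u v \<in> L2 (mu1 a)"
  unfolding gradient_def[abs_def] by (intro L2_add weighted_L2(1) graph_parts_L2[OF assms])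

lemma sqnorm_gradient_le:
  assumes "graph u v"
  shows "sqnorm (mu1 a) (gradient u v) \<le>
           2 * sqnorm (mu1 a) (odd_part v) + 2 * \<beta>\<^sup>2 * sqnorm (mu1 a) (odd_part u)"
  unfolding gradient_def[abs_def]
  using sqnorm_add_le[OF graph_parts_L2(4)[OF assms] weighted_L2(1)[OF graph_parts_L2(2)[OF assms]]]
    weighted_L2(2)[OF graph_parts_L2(2)[OF assms]]
  by (simp add: mult.assoc)

lemma even_part_derivative:
  assumes "f \<in> D"
  shows "(even_part f has_real_derivative gradient f (telegraph_gen a f) x) (at x)"
proof -
  have "(even_part f has_real_derivative (dx f (x, 1) + dx f (x, -1)) / 2) (at x)"
    unfolding even_part_def[abs_def]
    by (intro DERIV_cdivide DERIV_add core_derivative assms) auto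
  moreover have "(dx f (x, 1) + dx f (x, -1)) / 2 = gradient f (telegraph_gen a f) x"
    by (simp add: gradient_def odd_part_def telegraph_gen_def field_simps)
  ultimately show ?thesis by simp
qed

lemma odd_part_derivative:
  assumes "f \<in> D"
  shows "(odd_part f has_real_derivative
           even_part (telegraph_gen a f) x + (a x 1 - a x (-1)) * odd_part f x) (at x)"
proof -
  have "(odd_part f has_real_derivative (dx f (x, 1) - dx f (x, -1)) / 2) (at x)"
    unfolding odd_part_def[abs_def]
    by (intro DERIV_cdivide DERIV_diff core_derivative assms) auto
  moreover have "(dx f (x, 1) - dx f (x, -1)) / 2 =
      even_part (telegraph_gen a f) x + (a x 1 - a x (-1)) * odd_part f x"
    by (simp add: odd_part_def even_part_def telegraph_gen_def field_simps)
  ultimately show ?thesis by simp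
qed

text \<open>The integrand is the derivative of \<open>even_part f * odd_part g\<close> times the density of the invariant
  measure: the derivative of the density cancels the jump term in the even part of the
  generator. This is where the special form of the potential is used.\<close>

lemma flux_identity_core:
  assumes f: "f \<in> D" and g: "g \<in> D"
  shows "inner1 (even_part f) (even_part (telegraph_gen a g)) =
         - inner1 (gradient f (telegraph_gen a f)) (odd_part g)"
proof -
  note F = core_graph[OF f] and G = core_graph[OF g]
  let ?w = "\<lambda>x. exp (- potential a x) / partition_function"
  let ?h' = "\<lambda>x. gradient f (telegraph_gen a f) x * odd_part g x + even_part f x * even_part (telegraph_gen a g) x"
  have i1: "integrable (mu1 a) (\<lambda>x. even_part f x * odd_part g x)"
    by (intro L2_mult_integrable graph_parts_L2[OF F] graph_parts_L2[OF G])
  have i2: "integrable (mu1 a) (\<lambda>x. gradient f (telegraph_gen a f) x * odd_part g x)"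
    by (intro L2_mult_integrable gradient_L2[OF F] graph_parts_L2[OF G])
  have i3: "integrable (mu1 a) (\<lambda>x. even_part f x * even_part (telegraph_gen a g) x)"
    by (intro L2_mult_integrable graph_parts_L2[OF F] graph_parts_L2[OF G])
  have i4: "integrable (mu1 a) ?h'"
    using i2 i3 by simp
  have m: "h \<in> borel_measurable borel" if "integrable (mu1 a) h" for h :: "real \<Rightarrow> real"
    using borel_measurable_integrable[OF that] by (simp add: measurable_mu1)
  have "(\<integral>x. ?w x * ?h' x \<partial>lborel) = 0"
  proof (rule integral_derivative_eq_0)
    show "((\<lambda>x. ?w x * (even_part f x * odd_part g x)) has_real_derivative ?w x * ?h' x) (at x)" for x
      using partition_function_pos
      by (auto intro!: derivative_eq_intros even_part_derivative[OF f] odd_part_derivative[OF g]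
            potential_derivative simp: algebra_simps add_divide_distrib diff_divide_distrib)
    show "integrable lborel (\<lambda>x. ?w x * (even_part f x * odd_part g x))"
      using i1 by (simp add: integral_mu1(2)[OF m[OF i1]])
    show "integrable lborel (\<lambda>x. ?w x * ?h' x)"
      using i4 by (simp add: integral_mu1(2)[OF m[OF i4]])
  qed
  then have "(\<integral>x. ?h' x \<partial>mu1 a) = 0"
    by (simp add: integral_mu1(1)[OF m[OF i4]])
  then show ?thesis
    using i2 i3 by simp
qed

text \<open>The Poincare inequality for the centred even part. The mean is kept explicit because the mean
  of an approximating sequence need not vanish.\<close>

lemma poincare_core:
  assumes f: "f \<in> D"
  shows "c * (sqnorm (mu1 a) (even_part f) - (\<integral>x. even_part f x \<partial>mu1 a)\<^sup>2)
           \<le> sqnorm (mu1 a) (gradient f (telegraph_gen a f))"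
proof -
  note F = core_graph[OF f]
  define m where "m = (\<integral>x. even_part f x \<partial>mu1 a)"
  have prob: "measure (mu1 a) UNIV = 1"
    using mu1.prob_space by simp
  have int: "integrable (mu1 a) (even_part f)"
    using L2_mult_integrable[OF one_L2(2) graph_parts_L2(1)[OF F]] by simp
  have L2: "(\<lambda>x. even_part f x - m) \<in> L2 (mu1 a)"
    using L2_diff[OF graph_parts_L2(1)[OF F] L2_cmult[OF one_L2(2), of m]] by simp
  have "gradient f (telegraph_gen a f) = (\<lambda>x. (dx f (x, 1) + dx f (x, -1)) / 2)"
    by (rule ext) (simp add: gradient_def odd_part_def telegraph_gen_def field_simps)
  then have "continuous_on UNIV (gradient f (telegraph_gen a f))"
    using core_C1[OF f] by (auto intro!: continuous_intros)
  moreover have "((\<lambda>x. even_part f x - m) has_real_derivative gradient f (telegraph_gen a f) x) (at x)" for x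
    using even_part_derivative[OF f] by (auto intro!: derivative_eq_intros)
  moreover have "(\<integral>x. even_part f x - m \<partial>mu1 a) = 0"
    using int by (simp add: m_def prob)
  ultimately have "c * sqnorm (mu1 a) (\<lambda>x. even_part f x - m) \<le> sqnorm (mu1 a) (gradient f (telegraph_gen a f))"
    using poincare_mu1 L2 gradient_L2[OF F] unfolding poincare_def by blast
  moreover have "sqnorm (mu1 a) (\<lambda>x. even_part f x - m) = sqnorm (mu1 a) (even_part f) - m\<^sup>2"
  proof -
    have "sqnorm (mu1 a) (\<lambda>x. even_part f x - m)
        = (\<integral>x. (even_part f x)\<^sup>2 - 2 * m * even_part f x + m\<^sup>2 \<partial>mu1 a)"
      unfolding sqnorm_def by (rule Bochner_Integration.integral_cong) (auto simp: power2_diff)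
    also have "\<dots> = sqnorm (mu1 a) (even_part f) - 2 * m * m + m\<^sup>2"
      using int L2_integrable_square[OF graph_parts_L2(1)[OF F]]
      by (simp add: sqnorm_def m_def prob)
    finally show ?thesis by (simp add: power2_eq_square)
  qed
  ultimately show ?thesis by (simp add: m_def)
qed

lemma parts_diff:
  "even_part (\<lambda>z. f z - u z) = (\<lambda>x. even_part f x - even_part u x)"
  "odd_part (\<lambda>z. f z - u z) = (\<lambda>x. odd_part f x - odd_part u x)"
  by (auto simp: even_part_def odd_part_def field_simps)

lemma parts_tendsto:
  assumes lim: "((\<lambda>n. sqnorm (mu a) (\<lambda>z. f n z - u z)) \<longlongrightarrow> 0) F"
    and f: "\<forall>\<^sub>F n in F. f n \<in> L2 (mu a)" and u: "u \<in> L2 (mu a)"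
  shows "((\<lambda>n. sqnorm (mu1 a) (\<lambda>x. even_part (f n) x - even_part u x)) \<longlongrightarrow> 0) F"
    and "((\<lambda>n. sqnorm (mu1 a) (\<lambda>x. odd_part (f n) x - odd_part u x)) \<longlongrightarrow> 0) F"
proof -
  have "\<forall>\<^sub>F n in F. norm (sqnorm (mu1 a) (\<lambda>x. even_part (f n) x - even_part u x))
      \<le> sqnorm (mu a) (\<lambda>z. f n z - u z)"
    using f by eventually_elim
      (use u sqnorm_parts_le(1)[OF L2_diff] in \<open>simp add: sqnorm_nonneg parts_diff\<close>)
  then show "((\<lambda>n. sqnorm (mu1 a) (\<lambda>x. even_part (f n) x - even_part u x)) \<longlongrightarrow> 0) F"
    using lim by (rule Lim_null_comparison)
  have "\<forall>\<^sub>F n in F. norm (sqnorm (mu1 a) (\<lambda>x. odd_part (f n) x - odd_part u x))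
      \<le> sqnorm (mu a) (\<lambda>z. f n z - u z)"
    using f by eventually_elim
      (use u sqnorm_parts_le(2)[OF L2_diff] in \<open>simp add: sqnorm_nonneg parts_diff\<close>)
  then show "((\<lambda>n. sqnorm (mu1 a) (\<lambda>x. odd_part (f n) x - odd_part u x)) \<longlongrightarrow> 0) F"
    using lim by (rule Lim_null_comparison)
qed

text \<open>The quantities in \<open>flux_identity_core\<close> and \<open>poincare_core\<close> are continuous in the graph norm. The gradient
  converges because it is a bounded combination of the odd parts of \<open>u\<close> and \<open>v\<close>.\<close>

lemma graph_approximation:
  assumes G: "graph u v"
  obtains f where "\<And>n::nat. f n \<in> D"
    "(\<lambda>n. sqnorm (mu1 a) (\<lambda>x. even_part (f n) x - even_part u x)) \<longlonglongrightarrow> 0"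
    "(\<lambda>n. sqnorm (mu1 a) (\<lambda>x. odd_part (f n) x - odd_part u x)) \<longlonglongrightarrow> 0"
    "(\<lambda>n. sqnorm (mu1 a) (\<lambda>x. even_part (telegraph_gen a (f n)) x - even_part v x)) \<longlonglongrightarrow> 0"
    "(\<lambda>n. sqnorm (mu1 a) (\<lambda>x. gradient (f n) (telegraph_gen a (f n)) x - gradient u v x)) \<longlonglongrightarrow> 0"
proof -
  obtain f where f: "\<And>n::nat. f n \<in> D" and lim: "(\<lambda>n. sqnorm (mu a) (\<lambda>z. f n z - u z)) \<longlonglongrightarrow> 0"
      "(\<lambda>n. sqnorm (mu a) (\<lambda>z. telegraph_gen a (f n) z - v z)) \<longlonglongrightarrow> 0"
    using core_approximation[OF core G] by blast
  note Gf = core_graph[OF f]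
  note u = generator_graph_L2(1)[OF G] and v = generator_graph_L2(2)[OF G]
  note fL2 = generator_graph_L2(1)[OF Gf] and gL2 = generator_graph_L2(2)[OF Gf]
  note limf = parts_tendsto[OF lim(1) always_eventually[OF allI[OF fL2]] u]
  note limg = parts_tendsto[OF lim(2) always_eventually[OF allI[OF gL2]] v]
  let ?e = "\<lambda>n. sqnorm (mu1 a) (\<lambda>x. gradient (f n) (telegraph_gen a (f n)) x - gradient u v x)"
  let ?b = "\<lambda>n. 2 * sqnorm (mu1 a) (\<lambda>x. odd_part (telegraph_gen a (f n)) x - odd_part v x)
      + 2 * (\<beta>\<^sup>2 * sqnorm (mu1 a) (\<lambda>x. odd_part (f n) x - odd_part u x))"
  have "norm (?e n) \<le> ?b n" for n
  proof -
    have 1: "(\<lambda>x. odd_part (f n) x - odd_part u x) \<in> L2 (mu1 a)"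
      and 2: "(\<lambda>x. odd_part (telegraph_gen a (f n)) x - odd_part v x) \<in> L2 (mu1 a)"
      by (intro L2_diff graph_parts_L2[OF G] graph_parts_L2[OF Gf])+
    have "?e n = sqnorm (mu1 a) (\<lambda>x. (odd_part (telegraph_gen a (f n)) x - odd_part v x)
        + total_rate x * (odd_part (f n) x - odd_part u x))"
      by (rule arg_cong[where f = "sqnorm (mu1 a)"]) (auto simp: gradient_def algebra_simps)
    also have "\<dots> \<le> ?b n"
      using sqnorm_add_le[OF 2 weighted_L2(1)[OF 1]] weighted_L2(2)[OF 1] by linarith
    finally show ?thesis by (simp add: sqnorm_nonneg)
  qed
  then have "\<forall>\<^sub>F n in sequentially. norm (?e n) \<le> ?b n" by simp
  moreover have "?b \<longlonglongrightarrow> 0"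
    using limf(2) limg(2) by (auto intro!: tendsto_eq_intros)
  ultimately have lime: "?e \<longlonglongrightarrow> 0"
    by (rule Lim_null_comparison)
  show ?thesis
    by (rule that[of f, OF f limf limg(1) lime])
qed

lemma flux_identity:
  assumes G: "graph u v" and G': "graph w z"
  shows "inner1 (even_part u) (even_part z) = - inner1 (gradient u v) (odd_part w)"
proof -
  obtain f where f: "\<And>n::nat. f n \<in> D"
    "(\<lambda>n. sqnorm (mu1 a) (\<lambda>x. even_part (f n) x - even_part u x)) \<longlonglongrightarrow> 0"
    "(\<lambda>n. sqnorm (mu1 a) (\<lambda>x. odd_part (f n) x - odd_part u x)) \<longlonglongrightarrow> 0"
    "(\<lambda>n. sqnorm (mu1 a) (\<lambda>x. even_part (telegraph_gen a (f n)) x - even_part v x)) \<longlonglongrightarrow> 0"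
    "(\<lambda>n. sqnorm (mu1 a) (\<lambda>x. gradient (f n) (telegraph_gen a (f n)) x - gradient u v x)) \<longlonglongrightarrow> 0"
    by (rule graph_approximation[OF G], rule that; (assumption | erule meta_spec))
  obtain g where g: "\<And>n::nat. g n \<in> D"
    "(\<lambda>n. sqnorm (mu1 a) (\<lambda>x. even_part (g n) x - even_part w x)) \<longlonglongrightarrow> 0"
    "(\<lambda>n. sqnorm (mu1 a) (\<lambda>x. odd_part (g n) x - odd_part w x)) \<longlonglongrightarrow> 0"
    "(\<lambda>n. sqnorm (mu1 a) (\<lambda>x. even_part (telegraph_gen a (g n)) x - even_part z x)) \<longlonglongrightarrow> 0"
    "(\<lambda>n. sqnorm (mu1 a) (\<lambda>x. gradient (g n) (telegraph_gen a (g n)) x - gradient w z x)) \<longlonglongrightarrow> 0"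
    by (rule graph_approximation[OF G'], rule that; (assumption | erule meta_spec))
  note Gf = core_graph[OF f(1)] and Gg = core_graph[OF g(1)]
  have "(\<lambda>n. inner1 (even_part (f n)) (even_part (telegraph_gen a (g n))))
      \<longlonglongrightarrow> inner1 (even_part u) (even_part z)"
    by (intro inner_L2_tendsto f g always_eventually allI graph_parts_L2[OF Gf] graph_parts_L2[OF Gg]
          graph_parts_L2[OF G] graph_parts_L2[OF G'])
  moreover have "(\<lambda>n. - inner1 (gradient (f n) (telegraph_gen a (f n))) (odd_part (g n)))
      \<longlonglongrightarrow> - inner1 (gradient u v) (odd_part w)"
    by (intro tendsto_minus inner_L2_tendsto f g always_eventually allI gradient_L2[OF Gf]
          graph_parts_L2[OF Gg] gradient_L2[OF G] graph_parts_L2[OF G'])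
  ultimately show ?thesis
    using flux_identity_core[OF f(1) g(1)] by (simp add: LIMSEQ_unique)
qed

lemma poincare_graph:
  assumes G: "graph u v" and mean: "(\<integral>w. u w \<partial>mu a) = 0"
  shows "c * sqnorm (mu1 a) (even_part u) \<le> sqnorm (mu1 a) (gradient u v)"
proof -
  obtain f where f: "\<And>n::nat. f n \<in> D"
    "(\<lambda>n. sqnorm (mu1 a) (\<lambda>x. even_part (f n) x - even_part u x)) \<longlonglongrightarrow> 0"
    "(\<lambda>n. sqnorm (mu1 a) (\<lambda>x. odd_part (f n) x - odd_part u x)) \<longlonglongrightarrow> 0"
    "(\<lambda>n. sqnorm (mu1 a) (\<lambda>x. even_part (telegraph_gen a (f n)) x - even_part v x)) \<longlonglongrightarrow> 0"
    "(\<lambda>n. sqnorm (mu1 a) (\<lambda>x. gradient (f n) (telegraph_gen a (f n)) x - gradient u v x)) \<longlonglongrightarrow> 0"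
    by (rule graph_approximation[OF G], rule that; (assumption | erule meta_spec))
  note Gf = core_graph[OF f(1)]
  have "(\<lambda>n. inner1 (even_part (f n)) (even_part (f n))) \<longlonglongrightarrow> inner1 (even_part u) (even_part u)"
    by (intro inner_L2_tendsto f always_eventually allI graph_parts_L2[OF Gf] graph_parts_L2[OF G])
  moreover have "(\<lambda>n. inner1 (\<lambda>_. 1) (even_part (f n))) \<longlonglongrightarrow> inner1 (\<lambda>_. 1) (even_part u)"
    by (intro inner_L2_tendsto f always_eventually allI graph_parts_L2[OF Gf] graph_parts_L2[OF G] one_L2)
       (simp add: sqnorm_def)
  ultimately have lhs: "(\<lambda>n. c * (sqnorm (mu1 a) (even_part (f n)) - (\<integral>x. even_part (f n) x \<partial>mu1 a)\<^sup>2))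
      \<longlonglongrightarrow> c * (sqnorm (mu1 a) (even_part u) - (\<integral>x. even_part u x \<partial>mu1 a)\<^sup>2)"
    unfolding sqnorm_eq_integral_mult by (auto intro!: tendsto_intros)
  have rhs: "(\<lambda>n. sqnorm (mu1 a) (gradient (f n) (telegraph_gen a (f n)))) \<longlonglongrightarrow> sqnorm (mu1 a) (gradient u v)"
    unfolding sqnorm_eq_integral_mult
    by (intro inner_L2_tendsto f always_eventually allI gradient_L2[OF Gf] gradient_L2[OF G])
  have "c * (sqnorm (mu1 a) (even_part u) - (\<integral>x. even_part u x \<partial>mu1 a)\<^sup>2) \<le> sqnorm (mu1 a) (gradient u v)"
    by (rule LIMSEQ_le[OF lhs rhs]) (use poincare_core[OF f(1)] in auto)
  moreover have "(\<integral>x. even_part u x \<partial>mu1 a) = 0"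
    using integral_even_part[OF generator_graph_L2(1)[OF G]] mean by simp
  ultimately show ?thesis by simp
qed

end

section \<open>From a Lyapunov function to a third order inequality\<close>

text \<open>The inequality \<open>(\<partial>\<^sub>t + lam) [(\<partial>\<^sub>t + \<eta>)\<^sup>2 + \<nu>\<^sub>t] F \<le> 0\<close> for some \<open>\<nu> \<ge> \<nu>\<^sub>0\<close>, where the bracket is only required
  to be differentiable as a whole.\<close>

definition third_order_ineq :: "real \<Rightarrow> real \<Rightarrow> real \<Rightarrow> (real \<Rightarrow> real) \<Rightarrow> bool" where
  "third_order_ineq lam \<eta> \<nu>\<^sub>0 F \<longleftrightarrow>
     (\<exists>\<nu>. (\<forall>t\<ge>0. \<nu> t \<ge> \<nu>\<^sub>0) \<and> (\<exists>F' F'' g g'.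
        (\<forall>t\<ge>0. (F has_real_derivative F' t) (at t within {0..})) \<and>
        (\<forall>t\<ge>0. (F' has_real_derivative F'' t) (at t within {0..})) \<and>
        (\<forall>t\<ge>0. g t = F'' t + 2 * \<eta> * F' t + (\<eta>\<^sup>2 + \<nu> t) * F t) \<and>
        (\<forall>t\<ge>0. (g has_real_derivative g' t) (at t within {0..})) \<and>
        (\<forall>t\<ge>0. g' t + lam * g t \<le> 0)))"

text \<open>The function \<open>exp (k t) F t\<close> is nondecreasing.\<close>

lemma positive_of_derivative_bound:
  fixes F F' :: "real \<Rightarrow> real"
  assumes d: "\<And>t. t \<ge> 0 \<Longrightarrow> (F has_real_derivative F' t) (at t within {0..})"
    and lower: "\<And>t. t \<ge> 0 \<Longrightarrow> - k * F t \<le> F' t"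
    and "0 < F 0" and t: "0 \<le> t"
  shows "0 < F t"
proof -
  have dG: "((\<lambda>t. exp (k * t) * F t) has_real_derivative exp (k * s) * (F' s + k * F s)) (at s within {0..})"
    if "s \<ge> 0" for s
    using d[OF that] by (auto intro!: derivative_eq_intros simp: algebra_simps)
  have "exp (k * 0) * F 0 \<le> exp (k * t) * F t"
  proof (rule DERIV_nonneg_imp_increasing_open[OF t, of "\<lambda>t. exp (k * t) * F t"])
    fix s :: real assume s: "0 < s" "s < t"
    have "at s within {0..} = at s"
      by (rule at_within_interior) (use s in simp)
    with dG[of s] lower[of s] s
    show "\<exists>y. ((\<lambda>t. exp (k * t) * F t) has_real_derivative y) (at s) \<and> 0 \<le> y"
      by (intro exI[of _ "exp (k * s) * (F' s + k * F s)"]) simp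
  next
    show "continuous_on {0..t} (\<lambda>t. exp (k * t) * F t)"
      by (rule continuous_on_subset[of "{0..}"])
         (auto simp: continuous_on_eq_continuous_within intro!: DERIV_continuous dG)
  qed
  with \<open>0 < F 0\<close> have "0 < exp (k * t) * F t"
    by simp
  then show ?thesis
    by (simp add: zero_less_mult_iff)
qed

text \<open>The function \<open>\<nu>\<close> is chosen such that the bracket equals the given \<open>H\<close>. This needs \<open>F\<close> to
  be positive, which propagates from time \<open>0\<close>. If \<open>F\<close> vanishes initially
  then it vanishes forever by monotonicity, and everything can be taken to be zero.\<close>

lemma third_order_inequality:
  fixes F F' F'' H H' :: "real \<Rightarrow> real"
  assumes dF: "\<And>t. t \<ge> 0 \<Longrightarrow> (F has_real_derivative F' t) (at t within {0..})"
    and dF': "\<And>t. t \<ge> 0 \<Longrightarrow> (F' has_real_derivative F'' t) (at t within {0..})"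
    and dH: "\<And>t. t \<ge> 0 \<Longrightarrow> (H has_real_derivative H' t) (at t within {0..})"
    and nonneg: "\<And>t. t \<ge> 0 \<Longrightarrow> 0 \<le> F t"
    and decr: "\<And>t. t \<ge> 0 \<Longrightarrow> F' t \<le> 0"
    and lower: "\<And>t. t \<ge> 0 \<Longrightarrow> - k * F t \<le> F' t"
    and dominated: "\<And>t. t \<ge> 0 \<Longrightarrow> F'' t + F t \<le> H t"
    and H_decay: "\<And>t. t \<ge> 0 \<Longrightarrow> H' t + lam * H t \<le> 0"
  shows "third_order_ineq lam 1 0 F"
proof (cases "F 0 = 0")
  case True
  have F0: "F t = 0" if "t \<ge> 0" for t
  proof -
    have "F t \<le> F 0"
    proof (rule DERIV_nonpos_imp_decreasing_open[OF that])
      fix s :: real assume s: "0 < s" "s < t"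
      have "at s within {0..} = at s"
        by (rule at_within_interior) (use s in simp)
      with dF[of s] decr[of s] s show "\<exists>y. (F has_real_derivative y) (at s) \<and> y \<le> 0"
        by auto
    next
      show "continuous_on {0..t} F"
        by (rule continuous_on_subset[of "{0..}"])
           (auto simp: continuous_on_eq_continuous_within intro!: DERIV_continuous dF)
    qed
    with True nonneg[OF that] show ?thesis by simp
  qed
  have "(F has_real_derivative 0) (at t within {0..})" if "t \<ge> 0" for t
    by (rule has_field_derivative_transform_within[of "\<lambda>_. 0" _ _ _ 1])
       (use that F0 in auto)
  with F0 show ?thesis
    unfolding third_order_ineq_def
    by (intro exI[of _ "\<lambda>_. 0"] conjI) auto
next
  case False
  then have pos: "0 < F t" if "t \<ge> 0" for t
    using positive_of_derivative_bound[OF dF lower _ that] nonneg[of 0] by simp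
  define \<nu> where "\<nu> t = (H t - F'' t - 2 * F' t) / F t - 1" for t
  have \<nu>: "0 \<le> \<nu> t" if "t \<ge> 0" for t
    using pos[OF that] decr[OF that] dominated[OF that] by (simp add: \<nu>_def field_simps)
  have H_eq: "H t = F'' t + 2 * 1 * F' t + (1\<^sup>2 + \<nu> t) * F t" if "t \<ge> 0" for t
    using pos[OF that] by (simp add: \<nu>_def)
  show ?thesis
    unfolding third_order_ineq_def
    by (rule exI[of _ \<nu>], rule conjI[OF _ exI[of _ F', OF exI[of _ F'', OF exI[of _ H, OF exI[of _ H']]]]])
       (intro conjI allI impI \<nu> dF dF' dH H_decay H_eq; assumption)+
qed

section \<open>The dissipation of the Lyapunov function\<close>

context telegraph_core
begin

text \<open>Chosen such that twice the weight times \<open>\<alpha>\<close> is at least \<open>\<beta>\<^sup>2 + 3 + 2 (1 + \<beta>\<^sup>2) / c\<close>. Of this,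
  \<open>\<beta>\<^sup>2 + 2\<close> absorbs the mixed term in the derivative of the cross term, \<open>1\<close> yields the odd parts and
  the last summand yields the even part of \<open>u\<close> through the Poincare inequality. The
  additional summand \<open>1\<close> keeps the Lyapunov function coercive.\<close>

definition lyapunov_weight :: real where
  "lyapunov_weight = 1 + (\<beta>\<^sup>2 + 3 + 2 * (1 + \<beta>\<^sup>2) / c) / (2 * \<alpha>)"

lemma lyapunov_weight_ge: "1 \<le> lyapunov_weight"
  using total_rate_bounds(1) poincare_pos by (simp add: lyapunov_weight_def)

lemma weighted_bounds:
  assumes f: "f \<in> L2 (mu1 a)"
  shows "\<alpha> * sqnorm (mu1 a) f \<le> inner1 (\<lambda>x. total_rate x * f x) f"
    and "inner1 (\<lambda>x. total_rate x * f x) f \<le> \<beta> * sqnorm (mu1 a) f"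
proof -
  note sq = L2_integrable_square[OF f]
  have int: "integrable (mu1 a) (\<lambda>x. total_rate x * f x * f x)"
    by (intro L2_mult_integrable weighted_L2 f)
  have "(\<integral>x. \<alpha> * (f x)\<^sup>2 \<partial>mu1 a) \<le> inner1 (\<lambda>x. total_rate x * f x) f"
    using int sq total_rate_bounds(2)
    by (intro integral_mono) (auto simp: power2_eq_square mult.assoc intro!: mult_right_mono)
  then show "\<alpha> * sqnorm (mu1 a) f \<le> inner1 (\<lambda>x. total_rate x * f x) f"
    by (simp add: sqnorm_def)
  have "inner1 (\<lambda>x. total_rate x * f x) f \<le> (\<integral>x. \<beta> * (f x)\<^sup>2 \<partial>mu1 a)"
    using int sq total_rate_bounds(3)
    by (intro integral_mono) (auto simp: power2_eq_square mult.assoc intro!: mult_right_mono)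
  then show "inner1 (\<lambda>x. total_rate x * f x) f \<le> \<beta> * sqnorm (mu1 a) f"
    by (simp add: sqnorm_def)
qed

lemma inner1_commute: "inner1 f g = inner1 g f"
  by (simp add: mult.commute)

lemma inner1_gradient:
  assumes "graph u v" and g: "g \<in> L2 (mu1 a)"
  shows "inner1 (gradient u v) g = inner1 (odd_part v) g + inner1 (\<lambda>x. total_rate x * odd_part u x) g"
proof -
  note 1 = L2_mult_integrable[OF graph_parts_L2(4)[OF assms(1)] g]
  note 2 = L2_mult_integrable[OF weighted_L2(1)[OF graph_parts_L2(2)[OF assms(1)]] g]
  show ?thesis
    using Bochner_Integration.integral_add[OF 1 2] by (simp add: gradient_def distrib_right)
qed

text \<open>The flux identity is applied to the two pairs in both orders; the antisymmetric terms cancel.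
  With \<open>w = v\<close> the left-hand side is half the second time derivative of the squared norm, with
  \<open>w = u\<close> it is its first time derivative.\<close>

lemma dissipation_polarized:
  assumes G: "graph u v" and G': "graph w z"
  shows "inner1 (even_part u) (even_part z) + inner1 (odd_part u) (odd_part z)
       + inner1 (even_part v) (even_part w) + inner1 (odd_part v) (odd_part w)
       = - 2 * inner1 (\<lambda>x. total_rate x * odd_part u x) (odd_part w)"
proof -
  have "inner1 (even_part u) (even_part z)
      = - inner1 (odd_part v) (odd_part w) - inner1 (\<lambda>x. total_rate x * odd_part u x) (odd_part w)"
    using flux_identity[OF G G'] inner1_gradient[OF G graph_parts_L2(2)[OF G']] by simp
  moreover have "inner1 (even_part v) (even_part w)
      = - inner1 (odd_part u) (odd_part z) - inner1 (\<lambda>x. total_rate x * odd_part u x) (odd_part w)"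
    using flux_identity[OF G' G] inner1_gradient[OF G' graph_parts_L2(2)[OF G]]
    by (simp add: mult.commute mult.left_commute)
  ultimately show ?thesis by simp
qed

lemma dissipation:
  assumes "graph u v"
  shows "inner1 (even_part u) (even_part v) + inner1 (odd_part u) (odd_part v)
       = - inner1 (\<lambda>x. total_rate x * odd_part u x) (odd_part u)"
  using dissipation_polarized[OF assms assms]
  by (simp add: inner1_commute[of "even_part v"] inner1_commute[of "odd_part v"])

text \<open>The left-hand side is the time derivative of
  \<open>lyapunov_weight * (\<parallel>u\<parallel>\<^sup>2 + \<parallel>v\<parallel>\<^sup>2) - \<langle>even_part u, even_part v\<rangle>\<close> when \<open>u\<close>, \<open>v = L u\<close> and \<open>w = L v\<close> follow the
  flow. The flux identity turns \<open>\<langle>even_part u, even_part w\<rangle>\<close> into a product of the gradient with the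
  odd part of \<open>v\<close>, and both are controlled by the dissipated odd parts. The even part of \<open>u\<close>
  is then recovered from the gradient, while that of \<open>v\<close> appears with the right sign.\<close>

lemma lyapunov_dissipation:
  assumes G: "graph u v" "graph v w" and mean: "(\<integral>z. u z \<partial>mu a) = 0"
  shows "- 2 * lyapunov_weight * (inner1 (\<lambda>x. total_rate x * odd_part u x) (odd_part u)
                  + inner1 (\<lambda>x. total_rate x * odd_part v x) (odd_part v))
         - (sqnorm (mu1 a) (even_part v) + inner1 (even_part u) (even_part w))
         \<le> - (sqnorm (mu a) u + sqnorm (mu a) v)"
proof -
  define o\<^sub>0 o\<^sub>1 e\<^sub>0 e\<^sub>1 where "o\<^sub>0 = sqnorm (mu1 a) (odd_part u)"
    and "o\<^sub>1 = sqnorm (mu1 a) (odd_part v)" and "e\<^sub>0 = sqnorm (mu1 a) (even_part u)"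
    and "e\<^sub>1 = sqnorm (mu1 a) (even_part v)"
  note defs = o\<^sub>0_def o\<^sub>1_def e\<^sub>0_def e\<^sub>1_def
  let ?g = "sqnorm (mu1 a) (gradient u v)" and ?Q = "o\<^sub>0 + o\<^sub>1"
  have nn: "0 \<le> o\<^sub>0" "0 \<le> o\<^sub>1" by (simp_all add: defs sqnorm_nonneg)
  have g: "?g \<le> 2 * o\<^sub>1 + 2 * \<beta>\<^sup>2 * o\<^sub>0"
    using sqnorm_gradient_le[OF G(1)] by (simp add: defs)
  have "\<alpha> * ?Q \<le> inner1 (\<lambda>x. total_rate x * odd_part u x) (odd_part u)
                  + inner1 (\<lambda>x. total_rate x * odd_part v x) (odd_part v)" (is "_ \<le> ?diss")
    using weighted_bounds(1)[OF graph_parts_L2(2)[OF G(1)]] weighted_bounds(1)[OF graph_parts_L2(2)[OF G(2)]]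
    by (simp add: defs algebra_simps)
  then have "2 * lyapunov_weight * (\<alpha> * ?Q) \<le> 2 * lyapunov_weight * ?diss"
    using lyapunov_weight_ge by (intro mult_left_mono) auto
  moreover have "2 * lyapunov_weight * (\<alpha> * ?Q) = 2 * \<alpha> * ?Q + (\<beta>\<^sup>2 + 3) * ?Q + 2 * (1 + \<beta>\<^sup>2) * ?Q / c"
  proof -
    have "2 * lyapunov_weight * \<alpha> = 2 * \<alpha> + (\<beta>\<^sup>2 + 3 + 2 * (1 + \<beta>\<^sup>2) / c)"
      using total_rate_bounds(1) by (simp add: lyapunov_weight_def field_simps)
    then have "2 * lyapunov_weight * \<alpha> * ?Q = (2 * \<alpha> + (\<beta>\<^sup>2 + 3 + 2 * (1 + \<beta>\<^sup>2) / c)) * ?Q"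
      by (rule arg_cong)
    then show ?thesis by (simp add: algebra_simps add_divide_distrib)
  qed
  moreover have "e\<^sub>0 \<le> 2 * (1 + \<beta>\<^sup>2) * ?Q / c"
  proof -
    have "c * e\<^sub>0 \<le> 2 * o\<^sub>1 + 2 * \<beta>\<^sup>2 * o\<^sub>0"
      using poincare_graph[OF G(1) mean] g by (simp add: defs)
    also have "\<dots> \<le> 2 * (1 + \<beta>\<^sup>2) * ?Q"
      using nn by (simp add: algebra_simps)
    finally show ?thesis
      using poincare_pos by (simp add: field_simps)
  qed
  moreover have "- inner1 (even_part u) (even_part w) \<le> (\<beta>\<^sup>2 + 2) * ?Q"
  proof -
    have "- inner1 (even_part u) (even_part w) = inner1 (gradient u v) (odd_part v)"
      using flux_identity[OF G] by simp
    also have "2 * \<dots> \<le> ?g + o\<^sub>1"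
      using integral_mult_add_le[OF gradient_L2[OF G(1)] graph_parts_L2(2)[OF G(2)]]
      unfolding defs by linarith
    finally have "- 2 * inner1 (even_part u) (even_part w) \<le> 3 * o\<^sub>1 + 2 * \<beta>\<^sup>2 * o\<^sub>0"
      using g by linarith
    moreover have "(\<beta>\<^sup>2 + 2) * ?Q = \<beta>\<^sup>2 * o\<^sub>0 + \<beta>\<^sup>2 * o\<^sub>1 + 2 * o\<^sub>0 + 2 * o\<^sub>1"
      by (simp add: algebra_simps)
    moreover have "0 \<le> \<beta>\<^sup>2 * o\<^sub>1" using nn by simp
    ultimately show ?thesis using nn by linarith
  qed
  moreover have "0 \<le> \<alpha> * ?Q" using nn total_rate_bounds(1) by simp
  ultimately show ?thesis
    using sqnorm_parts[OF generator_graph_L2(1)[OF G(1)]]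
      sqnorm_parts[OF generator_graph_L2(1)[OF G(2)]]
    by (simp add: defs algebra_simps)
qed

text \<open>By polarization the second derivative only involves the odd parts of \<open>u\<close> and \<open>v\<close>.\<close>

lemma second_derivative_bound:
  assumes G: "graph u v" "graph v w"
  shows "2 * (inner1 (even_part v) (even_part v) + inner1 (even_part u) (even_part w)
            + (inner1 (odd_part v) (odd_part v) + inner1 (odd_part u) (odd_part w)))
         \<le> 2 * (1 + \<beta>\<^sup>2) * (sqnorm (mu a) u + sqnorm (mu a) v)"
proof -
  note L = weighted_L2[OF graph_parts_L2(2)[OF G(1)]]
  let ?o0 = "sqnorm (mu1 a) (odd_part u)" and ?o1 = "sqnorm (mu1 a) (odd_part v)"
  define I where "I = inner1 (\<lambda>x. total_rate x * odd_part u x) (odd_part v)"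
  have I: "2 * \<bar>I\<bar> \<le> \<beta>\<^sup>2 * ?o0 + ?o1"
    using integral_mult_add_le[OF L(1) graph_parts_L2(2)[OF G(2)]] L(2) by (simp add: I_def)
  have "2 * (inner1 (even_part v) (even_part v) + inner1 (even_part u) (even_part w)
            + (inner1 (odd_part v) (odd_part v) + inner1 (odd_part u) (odd_part w))) = - 4 * I"
    using dissipation_polarized[OF G] by (simp add: I_def)
  also have "\<dots> \<le> 2 * (2 * \<bar>I\<bar>)"
    by simp
  also have "\<dots> \<le> 2 * (\<beta>\<^sup>2 * ?o0 + ?o1)"
    using I by (intro mult_left_mono) auto
  also have "\<dots> \<le> 2 * ((1 + \<beta>\<^sup>2) * (?o0 + ?o1))"
    using sqnorm_nonneg[of "mu1 a" "odd_part u"] sqnorm_nonneg[of "mu1 a" "odd_part v"]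
    by (simp add: algebra_simps)
  also have "\<dots> \<le> 2 * ((1 + \<beta>\<^sup>2) * (sqnorm (mu a) u + sqnorm (mu a) v))"
    using sqnorm_parts_le(2)[OF generator_graph_L2(1)[OF G(1)]]
      sqnorm_parts_le(2)[OF generator_graph_L2(1)[OF G(2)]]
    by (intro mult_left_mono add_mono) auto
  finally show ?thesis by (simp only: mult.assoc)
qed

section \<open>The third order inequality along the flow\<close>

lemma parts_semigroup_derivative:
  assumes G: "graph u v" and t: "0 \<le> t"
  shows "L2_derivative_at (mu1 a) (\<lambda>s. even_part (P s u)) (even_part (P t v)) t"
    and "L2_derivative_at (mu1 a) (\<lambda>s. odd_part (P s u)) (odd_part (P t v)) t"
proof -
  note u = generator_graph_L2(1)[OF G] and v = generator_graph_L2(2)[OF G]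
  have lim: "((\<lambda>s. sqnorm (mu a) (\<lambda>z. (P s u z - P t u z) / (s - t) - P t v z)) \<longlongrightarrow> 0) (at t within {0..})"
    using semigroup_L2_derivative[OF semigroup G t] by (simp add: L2_derivative_at_def)
  have L2: "\<forall>\<^sub>F s in at t within {0..}. (\<lambda>z. (P s u z - P t u z) / (s - t)) \<in> L2 (mu a)"
    using eventually_nonneg_within
    by (rule eventually_mono) (intro L2_intros semigroup_L2[OF semigroup] u t)
  have parts: "even_part (\<lambda>z. (P s u z - P t u z) / (s - t)) = (\<lambda>x. (even_part (P s u) x - even_part (P t u) x) / (s - t))"
    "odd_part (\<lambda>z. (P s u z - P t u z) / (s - t)) = (\<lambda>x. (odd_part (P s u) x - odd_part (P t u) x) / (s - t))" for s
  proof -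
    have "((A - B) / d + (A' - B') / d) / 2 = ((A + A') / 2 - (B + B') / 2) / d"
      "((A - B) / d - (A' - B') / d) / 2 = ((A - A') / 2 - (B - B') / 2) / d" for A B A' B' d :: real
      by (cases "d = 0"; simp add: field_simps)+
    then show "even_part (\<lambda>z. (P s u z - P t u z) / (s - t)) = (\<lambda>x. (even_part (P s u) x - even_part (P t u) x) / (s - t))"
      "odd_part (\<lambda>z. (P s u z - P t u z) / (s - t)) = (\<lambda>x. (odd_part (P s u) x - odd_part (P t u) x) / (s - t))"
      unfolding even_part_def[abs_def] odd_part_def[abs_def] by (simp_all only:)
  qed
  show "L2_derivative_at (mu1 a) (\<lambda>s. even_part (P s u)) (even_part (P t v)) t"
    and "L2_derivative_at (mu1 a) (\<lambda>s. odd_part (P s u)) (odd_part (P t v)) t"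
    using parts_tendsto[OF lim L2 semigroup_L2[OF semigroup t v]]
    by (simp_all add: L2_derivative_at_def parts)
qed

lemma inner_parts_derivative:
  assumes G: "graph u v" "graph w z" and t: "0 \<le> t"
  shows "((\<lambda>s. inner1 (even_part (P s u)) (even_part (P s w))) has_real_derivative
           inner1 (even_part (P t v)) (even_part (P t w)) + inner1 (even_part (P t u)) (even_part (P t z)))
         (at t within {0..})"
    and "((\<lambda>s. inner1 (odd_part (P s u)) (odd_part (P s w))) has_real_derivative
           inner1 (odd_part (P t v)) (odd_part (P t w)) + inner1 (odd_part (P t u)) (odd_part (P t z)))
         (at t within {0..})"
proof -
  note L = graph_parts_L2[OF generator_graph_semigroup[OF semigroup G(1)]]
    graph_parts_L2[OF generator_graph_semigroup[OF semigroup G(2)]]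
  note d = parts_semigroup_derivative[OF G(1) t] parts_semigroup_derivative[OF G(2) t]
  show "((\<lambda>s. inner1 (even_part (P s u)) (even_part (P s w))) has_real_derivative
           inner1 (even_part (P t v)) (even_part (P t w)) + inner1 (even_part (P t u)) (even_part (P t z)))
         (at t within {0..})"
    by (rule inner_L2_has_derivative[OF d(1) d(3) L(1) L(3)[OF t] L(5) L(7)[OF t] t])
  show "((\<lambda>s. inner1 (odd_part (P s u)) (odd_part (P s w))) has_real_derivative
           inner1 (odd_part (P t v)) (odd_part (P t w)) + inner1 (odd_part (P t u)) (odd_part (P t z)))
         (at t within {0..})"
    by (rule inner_L2_has_derivative[OF d(2) d(4) L(2) L(4)[OF t] L(6) L(8)[OF t] t])
qed

lemma third_order_decay:
  assumes G0: "graph u\<^sub>0 u\<^sub>1" and G1: "graph u\<^sub>1 u\<^sub>2" and mean: "(\<integral>z. u\<^sub>0 z \<partial>mu a) = 0"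
    and F: "\<And>t. t \<ge> 0 \<Longrightarrow> F t = sqnorm (mu a) (P t u\<^sub>0)"
  shows "third_order_ineq (1 / (lyapunov_weight + 1/2)) 1 0 F"
proof -
  note G0t = generator_graph_semigroup[OF semigroup G0] and G1t = generator_graph_semigroup[OF semigroup G1]
  note L0 = generator_graph_L2(1)[OF G0t] and L1 = generator_graph_L2(1)[OF G1t]
  define e o' where "e i j t = inner1 (even_part (P t i)) (even_part (P t j))"
    and "o' i j t = inner1 (odd_part (P t i)) (odd_part (P t j))" for i j t
  define w where "w i t = inner1 (\<lambda>x. total_rate x * odd_part (P t i) x) (odd_part (P t i))" for i t
  define E where "E t = sqnorm (mu a) (P t u\<^sub>0) + sqnorm (mu a) (P t u\<^sub>1)" for t
  note eo = e_def[abs_def] o'_def[abs_def]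
  have sym: "e i j t = e j i t" "o' i j t = o' j i t" for i j t
    by (simp_all add: eo mult.commute)
  have norm0: "sqnorm (mu a) (P t u\<^sub>0) = e u\<^sub>0 u\<^sub>0 t + o' u\<^sub>0 u\<^sub>0 t"
    and norm1: "sqnorm (mu a) (P t u\<^sub>1) = e u\<^sub>1 u\<^sub>1 t + o' u\<^sub>1 u\<^sub>1 t" if "t \<ge> 0" for t
    using sqnorm_parts[OF L0[OF that]] sqnorm_parts[OF L1[OF that]]
    by (simp_all add: eo sqnorm_eq_integral_mult)
  have d00: "(e u\<^sub>0 u\<^sub>0 has_real_derivative 2 * e u\<^sub>0 u\<^sub>1 t) (at t within {0..})"
    "(o' u\<^sub>0 u\<^sub>0 has_real_derivative 2 * o' u\<^sub>0 u\<^sub>1 t) (at t within {0..})" if "t \<ge> 0" for t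
    using inner_parts_derivative[OF G0 G0 that] unfolding eo by (simp_all add: mult.commute)
  have d01: "(e u\<^sub>0 u\<^sub>1 has_real_derivative e u\<^sub>1 u\<^sub>1 t + e u\<^sub>0 u\<^sub>2 t) (at t within {0..})"
    "(o' u\<^sub>0 u\<^sub>1 has_real_derivative o' u\<^sub>1 u\<^sub>1 t + o' u\<^sub>0 u\<^sub>2 t) (at t within {0..})" if "t \<ge> 0" for t
    using inner_parts_derivative[OF G0 G1 that] unfolding eo by simp_all
  have d11: "(e u\<^sub>1 u\<^sub>1 has_real_derivative 2 * e u\<^sub>1 u\<^sub>2 t) (at t within {0..})"
    "(o' u\<^sub>1 u\<^sub>1 has_real_derivative 2 * o' u\<^sub>1 u\<^sub>2 t) (at t within {0..})" if "t \<ge> 0" for t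
    using inner_parts_derivative[OF G1 G1 that] unfolding eo by (simp_all add: mult.commute)
  have diss: "e u\<^sub>0 u\<^sub>1 t + o' u\<^sub>0 u\<^sub>1 t = - w u\<^sub>0 t" "e u\<^sub>1 u\<^sub>2 t + o' u\<^sub>1 u\<^sub>2 t = - w u\<^sub>1 t" if "t \<ge> 0" for t
    using dissipation[OF G0t[OF that]] dissipation[OF G1t[OF that]] by (simp_all add: eo w_def)
  \<comment> \<open>with this factor the lower bound \<open>C * E t / 2\<close> for \<open>H\<close> equals the upper bound for \<open>F'' + F\<close>\<close>
  define C where "C = 2 * (2 * (1 + \<beta>\<^sup>2) + 1)"
  define H where "H t = C * (lyapunov_weight * (e u\<^sub>0 u\<^sub>0 t + o' u\<^sub>0 u\<^sub>0 t + (e u\<^sub>1 u\<^sub>1 t + o' u\<^sub>1 u\<^sub>1 t)) - e u\<^sub>0 u\<^sub>1 t)" for t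
  define H' where "H' t = C * (lyapunov_weight * (2 * e u\<^sub>0 u\<^sub>1 t + 2 * o' u\<^sub>0 u\<^sub>1 t + (2 * e u\<^sub>1 u\<^sub>2 t + 2 * o' u\<^sub>1 u\<^sub>2 t))
      - (e u\<^sub>1 u\<^sub>1 t + e u\<^sub>0 u\<^sub>2 t))" for t
  have C_pos: "0 < C" by (simp add: C_def add_pos_nonneg)
  have E_nonneg: "0 \<le> E t" for t by (simp add: E_def sqnorm_nonneg)
  have cross: "2 * \<bar>e u\<^sub>0 u\<^sub>1 t\<bar> \<le> E t" if "t \<ge> 0" for t
    using integral_mult_add_le[OF graph_parts_L2(1)[OF G0t[OF that]] graph_parts_L2(1)[OF G1t[OF that]]]
      sqnorm_parts_le(1)[OF L0[OF that]] sqnorm_parts_le(1)[OF L1[OF that]]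
    by (simp add: eo E_def)
  have H_eq: "H t = C * (lyapunov_weight * E t - e u\<^sub>0 u\<^sub>1 t)" if "t \<ge> 0" for t
    using norm0[OF that] norm1[OF that] by (simp add: H_def E_def)
  show ?thesis
  proof (rule third_order_inequality)
    fix t :: real assume t: "t \<ge> 0"
    show "(F has_real_derivative 2 * (e u\<^sub>0 u\<^sub>1 t + o' u\<^sub>0 u\<^sub>1 t)) (at t within {0..})"
    proof (rule has_field_derivative_transform_within[of "\<lambda>t. e u\<^sub>0 u\<^sub>0 t + o' u\<^sub>0 u\<^sub>0 t" _ _ _ 1])
      show "((\<lambda>t. e u\<^sub>0 u\<^sub>0 t + o' u\<^sub>0 u\<^sub>0 t) has_real_derivative 2 * (e u\<^sub>0 u\<^sub>1 t + o' u\<^sub>0 u\<^sub>1 t)) (at t within {0..})"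
        using d00[OF t] by (auto intro!: derivative_eq_intros)
    qed (use t F norm0 in auto)
    show "((\<lambda>t. 2 * (e u\<^sub>0 u\<^sub>1 t + o' u\<^sub>0 u\<^sub>1 t)) has_real_derivative
        2 * (e u\<^sub>1 u\<^sub>1 t + e u\<^sub>0 u\<^sub>2 t + (o' u\<^sub>1 u\<^sub>1 t + o' u\<^sub>0 u\<^sub>2 t))) (at t within {0..})"
      using d01[OF t] by (auto intro!: derivative_eq_intros)
    show "(H has_real_derivative H' t) (at t within {0..})"
      unfolding H_def[abs_def] H'_def
      using d00[OF t] d01[OF t] d11[OF t] by (auto intro!: derivative_eq_intros)
    show "0 \<le> F t"
      using F[OF t] by (simp add: sqnorm_nonneg)
    have w0: "0 \<le> w u\<^sub>0 t" "w u\<^sub>0 t \<le> \<beta> * F t"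
    proof -
      let ?n = "sqnorm (mu1 a) (odd_part (P t u\<^sub>0))"
      note b = weighted_bounds[OF graph_parts_L2(2)[OF G0t[OF t]], folded w_def]
      have "0 \<le> \<alpha> * ?n" using total_rate_bounds(1) by (simp add: sqnorm_nonneg)
      with b(1) show "0 \<le> w u\<^sub>0 t" by linarith
      have "0 \<le> \<beta>" using total_rate_bounds(1) total_rate_bounds(2,3)[of 0] by linarith
      then have "\<beta> * ?n \<le> \<beta> * F t"
        using sqnorm_parts_le(2)[OF L0[OF t]] F[OF t] by (intro mult_left_mono) auto
      with b(2) show "w u\<^sub>0 t \<le> \<beta> * F t" by linarith
    qed
    show "2 * (e u\<^sub>0 u\<^sub>1 t + o' u\<^sub>0 u\<^sub>1 t) \<le> 0"
      using diss(1)[OF t] w0(1) by simp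
    show "- (2 * \<beta>) * F t \<le> 2 * (e u\<^sub>0 u\<^sub>1 t + o' u\<^sub>0 u\<^sub>1 t)"
      using diss(1)[OF t] w0(2) by simp
    show "2 * (e u\<^sub>1 u\<^sub>1 t + e u\<^sub>0 u\<^sub>2 t + (o' u\<^sub>1 u\<^sub>1 t + o' u\<^sub>0 u\<^sub>2 t)) + F t \<le> H t"
    proof -
      have "2 * (e u\<^sub>1 u\<^sub>1 t + e u\<^sub>0 u\<^sub>2 t + (o' u\<^sub>1 u\<^sub>1 t + o' u\<^sub>0 u\<^sub>2 t)) \<le> 2 * (1 + \<beta>\<^sup>2) * E t"
        using second_derivative_bound[OF G0t[OF t] G1t[OF t]] by (simp add: eo E_def)
      moreover have "F t \<le> E t"
        using F[OF t] by (simp add: E_def sqnorm_nonneg)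
      moreover have "C * (E t / 2) \<le> H t"
      proof -
        have "1 * E t \<le> lyapunov_weight * E t"
          using lyapunov_weight_ge E_nonneg by (intro mult_right_mono) auto
        then have "E t / 2 \<le> lyapunov_weight * E t - e u\<^sub>0 u\<^sub>1 t"
          using cross[OF t] by linarith
        then show ?thesis using C_pos by (simp add: H_eq[OF t])
      qed
      ultimately show ?thesis by (simp add: C_def algebra_simps)
    qed
    show "H' t + 1 / (lyapunov_weight + 1/2) * H t \<le> 0"
    proof -
      have "H' t \<le> C * (- E t)"
        unfolding H'_def
      proof (rule mult_left_mono)
        have "(\<integral>z. P t u\<^sub>0 z \<partial>mu a) = 0"
          using semigroup_integral[OF semigroup t generator_graph_L2(1)[OF G0]] mean by simp
        from lyapunov_dissipation[OF G0t[OF t] G1t[OF t] this]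
        have "- 2 * lyapunov_weight * (w u\<^sub>0 t + w u\<^sub>1 t) - (e u\<^sub>1 u\<^sub>1 t + e u\<^sub>0 u\<^sub>2 t) \<le> - E t"
          by (simp add: eo w_def E_def sqnorm_eq_integral_mult)
        moreover have eq: "2 * e u\<^sub>0 u\<^sub>1 t + 2 * o' u\<^sub>0 u\<^sub>1 t + (2 * e u\<^sub>1 u\<^sub>2 t + 2 * o' u\<^sub>1 u\<^sub>2 t) = - 2 * (w u\<^sub>0 t + w u\<^sub>1 t)"
          using diss[OF t] by simp
        ultimately show "lyapunov_weight * (2 * e u\<^sub>0 u\<^sub>1 t + 2 * o' u\<^sub>0 u\<^sub>1 t + (2 * e u\<^sub>1 u\<^sub>2 t + 2 * o' u\<^sub>1 u\<^sub>2 t))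
            - (e u\<^sub>1 u\<^sub>1 t + e u\<^sub>0 u\<^sub>2 t) \<le> - E t"
          unfolding eq by (simp add: algebra_simps)
      qed (use C_pos in simp)
      moreover have "H t / (lyapunov_weight + 1/2) \<le> C * E t"
      proof -
        have "lyapunov_weight * E t - e u\<^sub>0 u\<^sub>1 t \<le> (lyapunov_weight + 1/2) * E t"
          using cross[OF t] unfolding distrib_right by linarith
        then have "H t \<le> C * ((lyapunov_weight + 1/2) * E t)"
          unfolding H_eq[OF t] using C_pos by (intro mult_left_mono) auto
        then show ?thesis
          using lyapunov_weight_ge by (simp add: pos_divide_le_eq mult_ac)
      qed
      ultimately show ?thesis by simp
    qed
  qed
qed

end

text \<open>What remains is to check the hypotheses on the core. Its elements are smooth because they agree
  with \<^term>\<open>telegraph_semigroup a 0 f\<close>: both are continuous and they agree almost everywhere. The function is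
  then centred, and the flow of the centred function is followed.\<close>

theorem theorem3:
  fixes a :: "real \<Rightarrow> real \<Rightarrow> real"
    and cU :: real
    and D :: "(real \<times> real \<Rightarrow> real) set"
  assumes a_pos: "\<And>x y. y \<in> {-1, 1} \<Longrightarrow> a x y > 0"
    and a_smooth: "\<And>y. y \<in> {-1, 1} \<Longrightarrow> smooth (\<lambda>x. a x y)"
    and a_bounded: "\<And>y n. y \<in> {-1, 1} \<Longrightarrow> bounded (range ((deriv ^^ n) (\<lambda>x. a x y)))"
    and a_star: "(INF x. a x 1 + a x (-1)) > 0"
    and U_smooth: "smooth (potential a)"
    and U''_bounded: "bounded (range ((deriv ^^ 2) (potential a)))"
    and U_integrable: "integrable lborel (\<lambda>x. exp (- potential a x))"
    and cU_pos: "cU > 0"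
    and U_poincare: "poincare (mu1 a) cU"
    and P_markov: "markov_semigroup (mu a) (telegraph_semigroup a)"
    and D_differentiable:
      "\<And>f x y. f \<in> D \<Longrightarrow> y \<in> {-1, 1} \<Longrightarrow> (\<lambda>x. f (x, y)) field_differentiable at x"
    and D_core: "core_of (mu a) (telegraph_semigroup a) (telegraph_gen a) D"
    and D_dense: "dense_in_L2 (mu a) D"
    and D_stable: "\<And>f. f \<in> D \<Longrightarrow> telegraph_gen a f \<in> D"
    and reg_smooth: "\<And>f t y. f \<in> D \<Longrightarrow> t \<ge> 0 \<Longrightarrow> y \<in> {-1, 1} \<Longrightarrow>
           smooth (\<lambda>x. telegraph_semigroup a t f (x, y))"
    and reg_L2: "\<And>f t n. f \<in> D \<Longrightarrow> t \<ge> 0 \<Longrightarrow>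
           (dx ^^ n) (telegraph_semigroup a t f) \<in> L2 (mu a)"
    and reg_time: "\<And>f t. f \<in> D \<Longrightarrow> t \<ge> 0 \<Longrightarrow>
           (\<lambda>s. sqnorm (mu a) (dx (telegraph_semigroup a s f)))
             differentiable (at t within {0..})"
  shows "\<exists>lam \<eta> \<nu>\<^sub>0. lam > 0 \<and> \<eta> > 0 \<and>
           Re (complex_of_real \<eta> - csqrt (- complex_of_real \<nu>\<^sub>0)) > 0 \<and>
           (\<forall>f\<in>D. \<exists>\<nu>. (\<forall>t\<ge>0. \<nu> t \<ge> \<nu>\<^sub>0) \<and>
              (let F = (\<lambda>t. sqnorm (mu a)
                          (\<lambda>z. telegraph_semigroup a t f z - (\<integral>w. f w \<partial>mu a)))
               in \<exists>F' F'' g g'.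
                 (\<forall>t\<ge>0. (F has_real_derivative F' t) (at t within {0..})) \<and>
                 (\<forall>t\<ge>0. (F' has_real_derivative F'' t) (at t within {0..})) \<and>
                 (\<forall>t\<ge>0. g t = F'' t + 2 * \<eta> * F' t + (\<eta>\<^sup>2 + \<nu> t) * F t) \<and>
                 (\<forall>t\<ge>0. (g has_real_derivative g' t) (at t within {0..})) \<and>
                 (\<forall>t\<ge>0. g' t + lam * g t \<le> 0)))"
proof -
  define \<alpha> where "\<alpha> = (INF x. a x 1 + a x (-1))"
  have "bounded (range (\<lambda>x. a x 1))" "bounded (range (\<lambda>x. a x (-1)))"
    using a_bounded[of 1 0] a_bounded[of "-1" 0] by simp_all
  then obtain b\<^sub>1 b\<^sub>2 where b: "\<And>x. \<bar>a x 1\<bar> \<le> b\<^sub>1" "\<And>x. \<bar>a x (-1)\<bar> \<le> b\<^sub>2"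
    unfolding bounded_iff by auto
  have smooth_differentiable: "(\<lambda>x. g x) field_differentiable at x"
    and smooth_deriv_differentiable: "deriv g field_differentiable at x"
    if "smooth g" for g :: "real \<Rightarrow> real" and x
    using that[unfolded smooth_def, rule_format, of 0 x] that[unfolded smooth_def, rule_format, of 1 x]
    by simp_all
  have differentiable_continuous: "continuous_on UNIV g" if "\<And>x. g field_differentiable at x"
    for g :: "real \<Rightarrow> real"
    using that by (simp add: continuous_at_imp_continuous_on field_differentiable_imp_continuous_at)
  interpret telegraph_rates a \<alpha> "b\<^sub>1 + b\<^sub>2"
  proof
    fix x y :: real
    show "0 < a x y" if "y \<in> {-1, 1}" using a_pos[OF that] .
    show "continuous_on UNIV (\<lambda>x. a x y)" if "y \<in> {-1, 1}"
      by (intro differentiable_continuous smooth_differentiable a_smooth[OF that])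
    show "0 < \<alpha>" using a_star by (simp add: \<alpha>_def)
    have "bdd_below (range (\<lambda>x. a x 1 + a x (-1)))"
      using a_pos[of 1] a_pos[of "-1"]
      by (intro bdd_belowI[of _ 0]) (auto simp: add_nonneg_nonneg less_imp_le)
    then show "\<alpha> \<le> a x 1 + a x (-1)"
      unfolding \<alpha>_def by (rule cINF_lower) simp
    show "a x 1 + a x (-1) \<le> b\<^sub>1 + b\<^sub>2"
      using b(1)[of x] b(2)[of x] by linarith
    show "integrable lborel (\<lambda>x. exp (- potential a x))" by (rule U_integrable)
  qed
  have D_L2: "f \<in> L2 (mu a)" if "f \<in> D" for f
    using D_dense that by (auto simp: dense_in_L2_def)
  have D_smooth: "smooth (\<lambda>x. f (x, y))" if f: "f \<in> D" and y: "y \<in> {-1, 1}" for f y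
  proof -
    have "(\<lambda>x. telegraph_semigroup a 0 f (x, y)) = (\<lambda>x. f (x, y))"
      by (rule AE_mu_imp_eq[OF semigroup_zero[OF P_markov D_L2[OF f]] y])
         (intro differentiable_continuous smooth_differentiable reg_smooth D_differentiable f y order_refl)+
    then show ?thesis
      using reg_smooth[OF f order_refl y] by simp
  qed
  interpret telegraph_core a \<alpha> "b\<^sub>1 + b\<^sub>2" "telegraph_semigroup a" D cU
  proof
    show "markov_semigroup (mu a) (telegraph_semigroup a)" by (rule P_markov)
    show "core_of (mu a) (telegraph_semigroup a) (telegraph_gen a) D" by (rule D_core)
    show "poincare (mu1 a) cU" by (rule U_poincare)
    show "0 < cU" by (rule cU_pos)
    fix f and y :: real assume f: "f \<in> D" and y: "y \<in> {-1, 1}"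
    show "((\<lambda>x. f (x, y)) has_real_derivative dx f (x, y)) (at x)" for x
      using D_differentiable[OF f y, of x] by (simp add: dx_def DERIV_deriv_iff_field_differentiable)
    show "continuous_on UNIV (\<lambda>x. dx f (x, y))"
      using differentiable_continuous[OF smooth_deriv_differentiable[OF D_smooth[OF f y]]]
      by (simp add: dx_def)
  qed
  have decay: "third_order_ineq (1 / (lyapunov_weight + 1/2)) 1 0
      (\<lambda>t. sqnorm (mu a) (\<lambda>z. telegraph_semigroup a t f z - (\<integral>w. f w \<partial>mu a)))" if f: "f \<in> D" for f
  proof -
    define m where "m = (\<integral>w. f w \<partial>mu a)"
    define u\<^sub>0 where "u\<^sub>0 = (\<lambda>z. - m * 1 + f z)"
    have G: "graph u\<^sub>0 (telegraph_gen a f)"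
      unfolding u\<^sub>0_def by (rule generator_graph_add_const[OF P_markov core_graph[OF f] one_L2(1)])
    have "even_part u\<^sub>0 = (\<lambda>x. even_part f x - m)"
      by (rule ext) (simp add: even_part_def u\<^sub>0_def field_simps)
    moreover have "integrable (mu1 a) (even_part f)"
      using L2_mult_integrable[OF one_L2(2) parts_L2(1)[OF D_L2[OF f]]] by simp
    moreover have "m = (\<integral>x. even_part f x \<partial>mu1 a)"
      unfolding m_def by (rule integral_even_part[OF D_L2[OF f]])
    moreover have "measure (mu1 a) UNIV = 1"
      using mu1.prob_space by simp
    ultimately have mean: "(\<integral>z. u\<^sub>0 z \<partial>mu a) = 0"
      using integral_even_part[OF generator_graph_L2(1)[OF G]] by simp
    show ?thesis
    proof (rule third_order_decay[OF G core_graph[OF D_stable[OF f]] mean])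
      fix t :: real assume t: "0 \<le> t"
      have "AE z in mu a. telegraph_semigroup a t f z - m = telegraph_semigroup a t u\<^sub>0 z"
        using semigroup_lincomb[OF P_markov t one_L2(1) D_L2[OF f], of "- m"] semigroup_one[OF P_markov t]
        unfolding u\<^sub>0_def by eventually_elim simp
      moreover have "(\<lambda>z. telegraph_semigroup a t f z - m) \<in> L2 (mu a)"
        using L2_diff[OF semigroup_L2[OF P_markov t D_L2[OF f]] L2_cmult[OF one_L2(1), of m]] by simp
      ultimately show "sqnorm (mu a) (\<lambda>z. telegraph_semigroup a t f z - (\<integral>w. f w \<partial>mu a))
          = sqnorm (mu a) (telegraph_semigroup a t u\<^sub>0)"
        using semigroup_L2[OF P_markov t generator_graph_L2(1)[OF G]]
        unfolding m_def[symmetric] by (intro sqnorm_cong_AE)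
    qed
  qed
  have lam: "0 < 1 / (lyapunov_weight + 1/2)"
    using lyapunov_weight_ge by simp
  show ?thesis
    by (rule exI[of _ "1 / (lyapunov_weight + 1/2)"], rule exI[of _ 1], rule exI[of _ 0],
        unfold Let_def third_order_ineq_def[symmetric])
       (use lam decay in simp)
qed

end
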